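(* Fix $\varepsilon\in(0,1/2)$. There exists $N_0=N_0(\varepsilon)$ such that for every integer $N\ge N_0$ and every set $A\subseteq[1,N]$ of integers with $|A|\ge (1-1/e+\varepsilon)N$, there exists a subset $A'\subseteq A$ with \[\sum_{n\in A'}\frac1n = 1.\]
   Context: $[1,N]$ denotes the set of integers $\{1,\dots,N\}$, and $e$ is the base of the natural logarithm. *)

theory Defs
  imports Complex_Main
begin

end

theory Submission
  imports Defs "HOL-Computational_Algebra.Primes"
begin

text \<open>
Write \<open>R(X)\<close> for the sum of the reciprocals of the elements of \<open>X\<close>.

Density enters only through mass. Among all subsets of \<open>[1,N]\<close> of a given size, the top interval has
the smallest reciprocal sum, and that sum is about \<open>ln (N / (N - |A|))\<close> (\<open>recip_sum_ge\<close>). Hence a set of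
density above \<open>1 - 1/e\<close> has \<open>R(A) > 1\<close> by a constant margin, and the margin survives the deletion of a
small proportion of \<open>[1,N]\<close>. All inconvenient integers are deleted in this way.

The sum 1 is then found with characters. Choose a small part \<open>C\<close> of the set and a part \<open>B\<close> of the rest
so that \<open>R(B) + R(C)/2\<close> exceeds 1 by \<open>O(1/N)\<close> only. For \<open>S \<subseteq> C\<close> the number \<open>R(B) + R(S)\<close> lies strictly between 0
and 2, so it is 1 as soon as it is an integer. With \<open>P\<close> the least common multiple of the set, the number
of \<open>S\<close> with an integral sum is the mean over the frequencies \<open>h\<close> modulo \<open>P\<close> of
\<open>e(h R(B)) \<Prod>\<^sub>n (1 + e(h/n))\<close>, and a term has modulus \<open>2 ^ |C|\<close> times the product over \<open>n \<in> C\<close> of \<open>|cos (\<pi> h/n)|\<close>.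
If \<open>h\<close> is within a window length \<open>K\<close> of a multiple of \<open>P\<close>, the term has nonnegative real part, because
\<open>R(B) + R(C)/2\<close> is so close to 1; the frequency 0 gives the full \<open>2 ^ |C|\<close>. Everything hinges on showing that
the other frequencies contribute less (\<open>exists_integer_subsum\<close>, \<open>minor_arcs_sum_le\<close>).

Say that \<open>h\<close> misses \<open>n\<close> if no multiple of \<open>n\<close> is within \<open>K\<close> of \<open>h\<close>. Each missed \<open>n\<close> costs a factor
\<open>exp (- (K/N)\<^sup>2)\<close>. If very many elements of \<open>C\<close> are missed, the term is negligible even against all \<open>P\<close>
frequencies. Otherwise there is one integer \<open>x\<close> near \<open>h\<close> that is divisible by all of \<open>P\<close> except for a set
\<open>U\<close> of large primes, and many elements are missed for each prime in \<open>U\<close> (\<open>misses_dichotomy\<close>). The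
frequencies of this kind number at most \<open>O(K \<Prod>U)\<close> for each \<open>U\<close>, which the misses outweigh unless \<open>U\<close> is
empty; and then \<open>h\<close> is within \<open>K\<close> of a multiple of \<open>P\<close>.

The integer \<open>x\<close> arises as follows. Split \<open>n = s g\<close> into its \<open>y\<close>-smooth part \<open>s\<close> and its \<open>y\<close>-rough part \<open>g\<close>, where
\<open>y\<close> is a small power of \<open>N\<close>. As \<open>g > 2K\<close>, the window around \<open>h\<close> contains at most one multiple of \<open>g\<close>, so all
elements with rough part \<open>g\<close> that are not missed divide the same \<open>x\<close>, and their smooth parts are
divisors of that \<open>x\<close>. If \<open>x\<close> fails to be divisible by many small primes, in the sense of a large
reciprocal sum, Turan's sieve shows that only a small proportion of the possible smooth parts divide
\<open>x\<close>. So an element that is not missed typically divides an \<open>x\<close> that almost all small primes divide.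
Two such integers have a common divisor larger than \<open>2K\<close>, hence coincide. Every large prime for which
more than half of its multiples in \<open>C\<close> are not missed must therefore divide this single \<open>x\<close>
(\<open>card_bad_multiples_le\<close>, \<open>good_unique\<close>), and the smooth parts follow suit.

For this one needs that each prime above \<open>y\<close> and each smooth part that occurs at all occurs often in
\<open>C\<close>. Rare ones are pruned at small cost, and \<open>C\<close> collects the required number of representatives of each
of the others. The arithmetic input consists of Chebyshev's bound for the primes between \<open>n\<close> and \<open>2n\<close>
and of its consequences for reciprocal sums over primes.
\<close>

section \<open>Reciprocal sums over primes\<close>

definition primes_in :: "nat \<Rightarrow> nat \<Rightarrow> nat set" where
  "primes_in u v = {p. prime p \<and> u < p \<and> p \<le> v}"

lemma finite_primes_in [simp]: "finite (primes_in u v)"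
  unfolding primes_in_def by (rule finite_subset[of _ "{..v}"]) auto

lemma primes_inD:
  assumes "p \<in> primes_in u v" shows "prime p" "u < p" "p \<le> v" "2 \<le> p"
  using assms prime_ge_2_nat unfolding primes_in_def by auto

lemma primes_in_split:
  assumes "u \<le> w" "w \<le> v"
  shows "primes_in u v = primes_in u w \<union> primes_in w v" "primes_in u w \<inter> primes_in w v = {}"
  using assms unfolding primes_in_def by auto

lemma primes_in_mono: "u' \<le> u \<Longrightarrow> v \<le> v' \<Longrightarrow> primes_in u v \<subseteq> primes_in u' v'"
  unfolding primes_in_def by auto

lemma prod_primes_dvd:
  fixes x :: "'a :: {factorial_semiring_gcd}"
  assumes "finite P" "\<And>p. p \<in> P \<Longrightarrow> prime p" "\<And>p. p \<in> P \<Longrightarrow> p dvd x"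
  shows "\<Prod>P dvd x"
  using assms
proof (induction P rule: finite_induct)
  case (insert p P)
  have "coprime p (\<Prod>P)"
  proof (rule prod_coprime_right)
    fix q assume "q \<in> P"
    then show "coprime p q"
      using insert.hyps(2) insert.prems(1) by (metis insertCI primes_coprime)
  qed
  then show ?case
    using insert by (simp add: divides_mult)
qed simp

text \<open>
Chebyshev's argument: the primes between \<open>n\<close> and \<open>2n\<close> all divide the central binomial coefficient, which
is at most \<open>4 ^ n\<close>.
\<close>

lemma sum_ln_primes_doubling:
  "(\<Sum>p\<in>primes_in n (2 * n). ln (real p)) \<le> real n * ln 4"
proof -
  let ?P = "primes_in n (2 * n)"
  have "\<Prod>?P dvd (2 * n choose n)"
  proof (rule prod_primes_dvd)
    fix p assume p: "p \<in> ?P"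
    have "p dvd fact (2 * n)"
      using p prime_dvd_fact_iff primes_inD by blast
    moreover have "fact (2 * n) = fact n * fact n * (2 * n choose n)"
      using binomial_fact_lemma[of n "2 * n"] by (simp add: mult_2)
    moreover have "\<not> p dvd fact n"
      using p prime_dvd_fact_iff primes_inD by (metis not_le)
    ultimately show "p dvd (2 * n choose n)"
      using primes_inD(1)[OF p] by (simp add: prime_dvd_mult_iff)
  qed (auto dest: primes_inD)
  then have "\<Prod>?P \<le> (2 * n choose n)"
    by (rule dvd_imp_le) simp
  also have "\<dots> \<le> 2 ^ (2 * n)"
    by (rule binomial_le_pow2)
  finally have le: "real (\<Prod>?P) \<le> 4 ^ n"
    by (metis of_nat_le_iff of_nat_numeral of_nat_power power_mult power2_eq_square
        numeral_Bit0_eq_double mult_2 numeral_times_numeral semiring_norm(13) semiring_norm(11))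
  have "(\<Sum>p\<in>?P. ln (real p)) = ln (\<Prod>p\<in>?P. real p)"
    by (subst ln_prod) (auto dest: primes_inD)
  also have "\<dots> \<le> ln (4 ^ n)"
    using le by (subst ln_le_cancel_iff) (auto intro!: prod_pos dest: primes_inD)
  also have "\<dots> = real n * ln 4"
    by (simp add: ln_realpow)
  finally show ?thesis .
qed

lemma ln_4_bounds: "ln (4::real) = 2 * ln 2" "ln (2::real) \<le> 1" "ln (2::real) > 0"
proof -
  have "ln (4::real) = ln (2 ^ 2)" by simp
  then show "ln (4::real) = 2 * ln 2" by (metis ln_realpow of_nat_numeral zero_less_numeral)
  show "ln (2::real) \<le> 1" using ln_le_minus_one[of 2] by simp
qed auto

lemma sum_ln_over_primes_doubling:
  assumes "u \<ge> 1"
  shows "(\<Sum>p\<in>primes_in u (2 * u). ln (real p) / real p) \<le> ln 4"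
proof -
  have "(\<Sum>p\<in>primes_in u (2 * u). ln (real p) / real p) \<le> (\<Sum>p\<in>primes_in u (2 * u). ln (real p) / real u)"
    using assms by (intro sum_mono divide_left_mono) (auto dest: primes_inD)
  also have "\<dots> = (\<Sum>p\<in>primes_in u (2 * u). ln (real p)) / real u"
    by (simp add: sum_divide_distrib)
  also have "\<dots> \<le> ln 4"
    using sum_ln_primes_doubling[of u] assms by (simp add: field_simps)
  finally show ?thesis .
qed

text \<open>
Summing Chebyshev's bound over dyadic blocks. The factor 2 in front of the logarithm is
\<open>ln 4 / ln 2\<close>.
\<close>

lemma sum_ln_over_primes_le:
  assumes "1 \<le> u" "u \<le> v"
  shows "(\<Sum>p\<in>primes_in u v. ln (real p) / real p) \<le> 2 * ln (real v / real u) + 2"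
  using assms
proof (induction "v - u" arbitrary: u rule: less_induct)
  case less
  show ?case
  proof (cases "v \<le> 2 * u")
    case True
    have "(\<Sum>p\<in>primes_in u v. ln (real p) / real p) \<le> (\<Sum>p\<in>primes_in u (2 * u). ln (real p) / real p)"
      using True by (intro sum_mono2 primes_in_mono) (auto dest: primes_inD)
    also have "\<dots> \<le> ln 4"
      using less.prems by (intro sum_ln_over_primes_doubling)
    also have "ln 4 \<le> 2 * ln (real v / real u) + 2"
    proof -
      have "0 \<le> ln (real v / real u)" using less.prems by (intro ln_ge_zero) simp
      then show ?thesis using ln_4_bounds by linarith
    qed
    finally show ?thesis .
  next
    case False
    have IH: "(\<Sum>p\<in>primes_in (2 * u) v. ln (real p) / real p) \<le> 2 * ln (real v / real (2 * u)) + 2"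
      using False less.prems by (intro less.hyps) auto
    have split: "(\<Sum>p\<in>primes_in u v. ln (real p) / real p) =
       (\<Sum>p\<in>primes_in u (2 * u). ln (real p) / real p) + (\<Sum>p\<in>primes_in (2 * u) v. ln (real p) / real p)"
      using primes_in_split[of u "2 * u" v] False by (simp add: sum.union_disjoint)
    have "ln (real v / real (2 * u)) = ln (real v / real u) - ln 2"
      using less.prems False by (simp add: ln_div ln_mult)
    then show ?thesis
      using split IH sum_ln_over_primes_doubling[of u] less.prems ln_4_bounds by simp
  qed
qed

lemma sum_inverse_primes_le:
  assumes "2 \<le> u" "u \<le> v"
  shows "(\<Sum>p\<in>primes_in u v. 1 / real p) \<le> (2 * ln (real v / real u) + 2) / ln (real u)"
proof -
  have u: "ln (real u) > 0" using assms by simp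
  have "ln (real u) * (\<Sum>p\<in>primes_in u v. 1 / real p) \<le> (\<Sum>p\<in>primes_in u v. ln (real p) / real p)"
    unfolding sum_distrib_left using assms by (intro sum_mono) (auto simp: divide_simps dest: primes_inD)
  also have "\<dots> \<le> 2 * ln (real v / real u) + 2"
    using assms by (intro sum_ln_over_primes_le) auto
  finally show ?thesis using u by (simp add: field_simps)
qed

section \<open>Turan's sieve\<close>

lemma card_multiples:
  assumes "d > 0"
  shows "card {a \<in> {1..X}. d dvd a} = X div d"
proof -
  have "{a \<in> {1..X}. d dvd a} = (\<lambda>k. d * k) ` {1..X div d}"
  proof (intro equalityI subsetI)
    fix a assume "a \<in> {a \<in> {1..X}. d dvd a}"
    then obtain k where "a = d * k" "1 \<le> a" "a \<le> X" by auto
    then show "a \<in> (\<lambda>k. d * k) ` {1..X div d}"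
      using assms by (auto intro!: imageI simp: less_eq_div_iff_mult_less_eq mult.commute Suc_le_eq)
  next
    fix a assume "a \<in> (\<lambda>k. d * k) ` {1..X div d}"
    then show "a \<in> {a \<in> {1..X}. d dvd a}"
      using assms by (auto simp: less_eq_div_iff_mult_less_eq mult.commute Suc_le_eq)
  qed
  then show ?thesis
    using assms by (simp add: card_image inj_on_def)
qed

lemma card_multiples_le:
  assumes "d > 0"
  shows "real (card {a \<in> {1..X}. d dvd a}) \<le> real X / real d"
  using card_multiples[OF assms] of_nat_div_le_of_nat[of X d] by simp

lemma card_multiples_ge:
  assumes "d > 0"
  shows "real X / real d - 1 \<le> real (card {a \<in> {1..X}. d dvd a})"
proof -
  have "real X = real (X div d) * real d + real (X mod d)"
    by (metis div_mult_mod_eq of_nat_add of_nat_mult)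
  moreover have "real (X mod d) \<le> real d" using assms by simp
  ultimately show ?thesis
    using card_multiples[OF assms, of X] assms by (simp add: field_simps)
qed

text \<open>
The number of primes of \<open>T\<close> that divide \<open>a\<close> has mean about \<open>\<mu>\<close> and variance at most \<open>3 \<mu>\<close>, so by Chebyshev's
inequality it vanishes for at most a proportion \<open>3 / \<mu>\<close> of the \<open>a\<close>. The error made by replacing \<open>X div r\<close>
by \<open>X / r\<close> is at most 1 for each prime, which is why \<open>T\<close> may have up to \<open>X\<close> elements of any size.
\<close>

lemma Turan_sieve:
  assumes fin: "finite T" and pr: "\<And>r. r \<in> T \<Longrightarrow> prime r" and cT: "card T \<le> X"
    and mu: "\<mu> = (\<Sum>r\<in>T. 1 / real r)" "\<mu> > 0"
  shows "real (card {a \<in> {1..X}. \<forall>r\<in>T. \<not> r dvd a}) \<le> 3 * real X / \<mu>"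
proof -
  define w where "w a = (\<Sum>r\<in>T. of_bool (r dvd a) :: real)" for a
  have count: "(\<Sum>a\<in>{1..X}. of_bool (Q a) :: real) = real (card {a \<in> {1..X}. Q a})" for Q
    by (simp add: of_bool_def sum.If_cases Int_def)
  have pos: "r > 0" if "r \<in> T" for r using pr[OF that] by (simp add: prime_gt_0_nat)
  have S1: "(\<Sum>a\<in>{1..X}. w a) \<ge> real X * \<mu> - real X"
  proof -
    have "(\<Sum>a\<in>{1..X}. w a) = (\<Sum>r\<in>T. real (card {a \<in> {1..X}. r dvd a}))"
      unfolding w_def by (subst sum.swap) (simp only: count)
    also have "\<dots> \<ge> (\<Sum>r\<in>T. real X * (1 / real r) - 1)"
      using card_multiples_ge pos by (intro sum_mono) force
    also have "(\<Sum>r\<in>T. real X * (1 / real r) - 1) = real X * \<mu> - real (card T)"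
      unfolding sum_subtractf mu(1) sum_distrib_left by simp
    finally show ?thesis using cT by simp
  qed
  have S2: "(\<Sum>a\<in>{1..X}. (w a)\<^sup>2) \<le> real X * \<mu>\<^sup>2 + real X * \<mu>"
  proof -
    have "(\<Sum>a\<in>{1..X}. (w a)\<^sup>2) = (\<Sum>a\<in>{1..X}. \<Sum>r\<in>T. \<Sum>s\<in>T. of_bool (r dvd a \<and> s dvd a))"
      unfolding w_def power2_eq_square sum_product by (simp add: of_bool_conj)
    also have "\<dots> = (\<Sum>r\<in>T. \<Sum>a\<in>{1..X}. \<Sum>s\<in>T. of_bool (r dvd a \<and> s dvd a))"
      by (rule sum.swap)
    also have "\<dots> = (\<Sum>r\<in>T. \<Sum>s\<in>T. \<Sum>a\<in>{1..X}. of_bool (r dvd a \<and> s dvd a))"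
      by (intro sum.cong refl sum.swap)
    also have "\<dots> = (\<Sum>r\<in>T. \<Sum>s\<in>T. real (card {a \<in> {1..X}. r dvd a \<and> s dvd a}))"
      by (simp only: count)
    also have "\<dots> \<le> (\<Sum>r\<in>T. \<Sum>s\<in>T. real X * (1 / real r) * (1 / real s) + (if s = r then real X * (1 / real r) else 0))"
    proof (intro sum_mono)
      fix r s assume rs: "r \<in> T" "s \<in> T"
      show "real (card {a \<in> {1..X}. r dvd a \<and> s dvd a}) \<le>
        real X * (1 / real r) * (1 / real s) + (if s = r then real X * (1 / real r) else 0)"
      proof (cases "s = r")
        case True
        have "0 \<le> real X * (1 / real r) * (1 / real s)" by simp
        moreover have "real (card {a \<in> {1..X}. r dvd a \<and> s dvd a}) \<le> real X * (1 / real r)"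
          using card_multiples_le[OF pos[OF rs(1)], of X] True by simp
        ultimately show ?thesis using True by (simp add: add_increasing)
      next
        case False
        have "coprime r s" using pr rs False primes_coprime by blast
        then have "{a \<in> {1..X}. r dvd a \<and> s dvd a} = {a \<in> {1..X}. r * s dvd a}"
          by (auto intro: divides_mult dest: dvd_mult_left dvd_mult_right)
        then show ?thesis
          using card_multiples_le[of "r * s" X] pos rs False by simp
      qed
    qed
    also have "\<dots> = real X * \<mu>\<^sup>2 + real X * \<mu>"
      using fin unfolding mu(1) power2_eq_square sum_product
      by (simp add: sum.distrib sum_distrib_left sum_divide_distrib)
    finally show ?thesis .
  qed
  have "real (card {a \<in> {1..X}. \<forall>r\<in>T. \<not> r dvd a}) * \<mu>\<^sup>2 = (\<Sum>a\<in>{a \<in> {1..X}. \<forall>r\<in>T. \<not> r dvd a}. (w a - \<mu>)\<^sup>2)"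
    by (simp add: w_def)
  also have "\<dots> \<le> (\<Sum>a\<in>{1..X}. (w a - \<mu>)\<^sup>2)"
    by (rule sum_mono2) auto
  also have "\<dots> = (\<Sum>a\<in>{1..X}. (w a)\<^sup>2) - 2 * \<mu> * (\<Sum>a\<in>{1..X}. w a) + real X * \<mu>\<^sup>2"
    by (simp add: power2_diff sum.distrib sum_subtractf sum_distrib_left mult_ac)
  also have "\<dots> \<le> real X * \<mu>\<^sup>2 + real X * \<mu> - 2 * \<mu> * (real X * \<mu> - real X) + real X * \<mu>\<^sup>2"
    using S1 S2 mu(2) by (intro add_mono diff_mono mult_left_mono) auto
  also have "\<dots> = 3 * real X * \<mu>"
    by (simp add: power2_eq_square algebra_simps)
  finally show ?thesis
    using mu(2) by (simp add: field_simps power2_eq_square)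
qed

section \<open>Smooth and rough parts\<close>

definition smooth_part :: "nat \<Rightarrow> nat \<Rightarrow> nat" where
  "smooth_part y n = (\<Prod>p\<in>{p \<in> prime_factors n. p \<le> y}. p ^ multiplicity p n)"

definition rough_part :: "nat \<Rightarrow> nat \<Rightarrow> nat" where
  "rough_part y n = (\<Prod>p\<in>{p \<in> prime_factors n. y < p}. p ^ multiplicity p n)"

lemma smooth_mult_rough:
  assumes "n > 0" shows "smooth_part y n * rough_part y n = n"
proof -
  have "smooth_part y n * rough_part y n = (\<Prod>p\<in>prime_factors n. p ^ multiplicity p n)"
    unfolding smooth_part_def rough_part_def
    by (subst prod.union_disjoint [symmetric]) (auto intro!: prod.cong)
  also have "\<dots> = n"
    using assms prod_prime_factors[of n] by simp
  finally show ?thesis .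
qed

lemma smooth_part_pos: "n > 0 \<Longrightarrow> smooth_part y n > 0"
  using smooth_mult_rough[of n y] by (metis gr0I mult_is_0)

lemma coprime_smooth_rough: "coprime (smooth_part y n) (rough_part y n)"
  unfolding smooth_part_def rough_part_def
proof (rule prod_coprime_left, rule prod_coprime_right)
  fix p q assume "p \<in> {p \<in> prime_factors n. p \<le> y}" "q \<in> {p \<in> prime_factors n. y < p}"
  then have "coprime p q" by (intro primes_coprime) auto
  then show "coprime (p ^ multiplicity p n) (q ^ multiplicity q n)" by simp
qed

lemma multiplicity_eq_sum:
  assumes "prime p" "1 \<le> n" "n \<le> X"
  shows "real (multiplicity p n) = (\<Sum>k\<in>{1..X}. of_bool (p ^ k dvd n))"
proof -
  have p: "\<not> is_unit p" using assms(1) by auto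
  have "multiplicity p n < 2 ^ multiplicity p n" by simp
  also have "\<dots> \<le> p ^ multiplicity p n" using prime_ge_2_nat[OF assms(1)] by (simp add: power_mono)
  also have "\<dots> \<le> n" using assms by (intro dvd_imp_le multiplicity_dvd) auto
  finally have "multiplicity p n \<le> X" using assms by simp
  then have "{k \<in> {1..X}. p ^ k dvd n} = {1..multiplicity p n}"
    using p assms by (auto simp: power_dvd_iff_le_multiplicity)
  then show ?thesis
    by (simp add: of_bool_def sum.If_cases Int_def)
qed

lemma geometric_sum_le:
  fixes c :: real
  assumes "0 \<le> c" "c \<le> 1 / 2"
  shows "(\<Sum>k\<in>{1..m}. c ^ k) \<le> 2 * c"
proof -
  have "(\<Sum>k\<in>{1..m}. c ^ k) \<le> 2 * c - 2 * c * (1 / 2) ^ m"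
  proof (induction m)
    case (Suc m)
    have "c ^ m \<le> (1 / 2) ^ m" using assms by (intro power_mono)
    then have "c ^ Suc m \<le> c * (1 / 2) ^ m" using assms by (simp add: mult_left_mono)
    then show ?case using Suc by simp
  qed simp
  moreover have "2 * c * (1 / 2) ^ m \<ge> 0" using assms by simp
  ultimately show ?thesis by linarith
qed

lemma ln_smooth_part:
  assumes "n > 0"
  shows "ln (real (smooth_part y n)) = (\<Sum>p\<in>primes_in 1 y. real (multiplicity p n) * ln (real p))"
proof -
  let ?P = "{p \<in> prime_factors n. p \<le> y}"
  have "ln (real (smooth_part y n)) = (\<Sum>p\<in>?P. ln (real (p ^ multiplicity p n)))"
    unfolding smooth_part_def of_nat_prod
    by (subst ln_prod) (auto intro!: prime_gt_0_nat)
  also have "\<dots> = (\<Sum>p\<in>?P. real (multiplicity p n) * ln (real p))"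
    by (intro sum.cong refl) (auto simp: ln_realpow prime_gt_0_nat)
  also have "\<dots> = (\<Sum>p\<in>primes_in 1 y. real (multiplicity p n) * ln (real p))"
  proof (rule sum.mono_neutral_left)
    show "?P \<subseteq> primes_in 1 y"
      unfolding primes_in_def by (auto intro!: prime_gt_Suc_0_nat)
    show "\<forall>p\<in>primes_in 1 y - ?P. real (multiplicity p n) * ln (real p) = 0"
      using assms
      by (auto simp: primes_in_def prime_factors_dvd) (metis less_irrefl not_dvd_imp_multiplicity_0)
  qed simp
  finally show ?thesis .
qed

text \<open>
On average the smooth part of an integer is as small as a bounded power of \<open>y\<close>. By Markov's
inequality, smooth parts far above \<open>y\<close> are rare (\<open>card_large_smooth_part\<close>).
\<close>

lemma sum_ln_smooth_part_le:
  assumes "y \<ge> 1"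
  shows "(\<Sum>n\<in>{1..X}. ln (real (smooth_part y n))) \<le> 4 * real X * (ln (real y) + 1)"
proof -
  have "(\<Sum>n\<in>{1..X}. ln (real (smooth_part y n))) =
    (\<Sum>n\<in>{1..X}. \<Sum>p\<in>primes_in 1 y. real (multiplicity p n) * ln (real p))"
    by (intro sum.cong refl ln_smooth_part) auto
  also have "\<dots> = (\<Sum>p\<in>primes_in 1 y. \<Sum>n\<in>{1..X}. real (multiplicity p n) * ln (real p))"
    by (rule sum.swap)
  also have "\<dots> \<le> (\<Sum>p\<in>primes_in 1 y. 2 * real X * (ln (real p) / real p))"
  proof (rule sum_mono)
    fix p assume p: "p \<in> primes_in 1 y"
    have "(\<Sum>n\<in>{1..X}. real (multiplicity p n)) = (\<Sum>n\<in>{1..X}. \<Sum>k\<in>{1..X}. of_bool (p ^ k dvd n))"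
      using primes_inD[OF p] by (intro sum.cong refl multiplicity_eq_sum) auto
    also have "\<dots> = (\<Sum>k\<in>{1..X}. \<Sum>n\<in>{1..X}. of_bool (p ^ k dvd n))"
      by (rule sum.swap)
    also have "\<dots> = (\<Sum>k\<in>{1..X}. real (card {n \<in> {1..X}. p ^ k dvd n}))"
      by (intro sum.cong refl) (simp add: of_bool_def sum.If_cases Int_def)
    also have "\<dots> \<le> (\<Sum>k\<in>{1..X}. real X * (1 / real p) ^ k)"
    proof (rule sum_mono)
      fix k
      show "real (card {n \<in> {1..X}. p ^ k dvd n}) \<le> real X * (1 / real p) ^ k"
        using card_multiples_le[of "p ^ k" X] primes_inD[OF p] by (simp add: power_divide)
    qed
    also have "\<dots> = real X * (\<Sum>k\<in>{1..X}. (1 / real p) ^ k)"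
      by (simp add: sum_distrib_left)
    also have "\<dots> \<le> real X * (2 * (1 / real p))"
      using primes_inD[OF p] by (intro mult_left_mono geometric_sum_le) (auto simp: field_simps)
    finally have "(\<Sum>n\<in>{1..X}. real (multiplicity p n)) * ln (real p) \<le> real X * (2 * (1 / real p)) * ln (real p)"
      using primes_inD[OF p] by (intro mult_right_mono) auto
    then show "(\<Sum>n\<in>{1..X}. real (multiplicity p n) * ln (real p)) \<le> 2 * real X * (ln (real p) / real p)"
      unfolding sum_distrib_right[symmetric] by (simp add: mult_ac)
  qed
  also have "\<dots> = 2 * real X * (\<Sum>p\<in>primes_in 1 y. ln (real p) / real p)"
    by (simp add: sum_distrib_left)
  also have "\<dots> \<le> 2 * real X * (2 * ln (real y / real 1) + 2)"
    using assms by (intro mult_left_mono sum_ln_over_primes_le) auto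
  finally show ?thesis by (simp add: algebra_simps)
qed

lemma card_large_smooth_part:
  assumes "y \<ge> 1" "S > 1"
  shows "real (card {n \<in> {1..X}. real (smooth_part y n) > S}) \<le> real X * (4 * (ln (real y) + 1) / ln S)"
proof -
  let ?B = "{n \<in> {1..X}. real (smooth_part y n) > S}"
  have "real (card ?B) * ln S = (\<Sum>n\<in>?B. ln S)" by simp
  also have "\<dots> \<le> (\<Sum>n\<in>?B. ln (real (smooth_part y n)))"
    using assms by (intro sum_mono) auto
  also have "\<dots> \<le> (\<Sum>n\<in>{1..X}. ln (real (smooth_part y n)))"
    by (intro sum_mono2) (auto simp: Suc_le_eq smooth_part_pos)
  also have "\<dots> \<le> 4 * real X * (ln (real y) + 1)"
    using assms by (intro sum_ln_smooth_part_le)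
  finally show ?thesis
    using assms by (simp add: field_simps)
qed

lemma smooth_part_eq_self:
  assumes "n > 0" "\<And>p. prime p \<Longrightarrow> p dvd n \<Longrightarrow> p \<le> y"
  shows "smooth_part y n = n"
proof -
  have "{p \<in> prime_factors n. y < p} = {}"
    using assms by (auto simp: prime_factors_dvd not_less)
  then have "rough_part y n = 1" unfolding rough_part_def by (simp only: prod.empty)
  then show ?thesis using smooth_mult_rough[OF assms(1), of y] by simp
qed

lemma ln_ge_one_nat: "u \<ge> 3 \<Longrightarrow> 1 \<le> ln (real u)"
proof -
  assume "u \<ge> 3"
  then have "exp 1 \<le> real u" using exp_le by linarith
  then show ?thesis using \<open>u \<ge> 3\<close> by (subst ln_ge_iff) auto
qed

text \<open>
A lower bound for reciprocal sums without Mertens' theorem. An integer in \<open>[v/4, v]\<close> without a prime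
factor in \<open>(u, v]\<close> equals its own \<open>u\<close>-smooth part, which happens for at most a quarter of \<open>[1, v]\<close> when \<open>v\<close> is a
large power of \<open>u\<close>. All the other integers up to \<open>v\<close>, at least half of them, are multiples of a prime in
\<open>(u, v]\<close>.
\<close>

lemma sum_inverse_primes_ge_half:
  assumes u: "u \<ge> 3" and v: "v = u ^ 64"
  shows "(\<Sum>p\<in>primes_in u v. 1 / real p) \<ge> 1 / 2"
proof -
  let ?\<sigma> = "\<Sum>p\<in>primes_in u v. 1 / real p"
  have lnu: "1 \<le> ln (real u)" using ln_ge_one_nat u by simp
  have v0: "v > 0" using u v by simp
  have lnv: "ln (real v) = 64 * ln (real u)"
    using u v by (simp add: ln_realpow)
  have lnv4: "ln (real v / 4) \<ge> 32 * ln (real u)"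
    using v0 lnv lnu ln_4_bounds by (simp add: ln_div)
  then have v4: "real v / 4 > 1"
    using lnu v0 ln_le_zero_iff[of "real v / 4"] by (smt (verit) divide_pos_pos of_nat_0_less_iff)
  define A where "A = {1..v div 4}"
  define B where "B = {n \<in> {1..v}. real (smooth_part u n) > real v / 4}"
  define D where "D p = {n \<in> {1..v}. p dvd n}" for p
  have "{1..v} \<subseteq> A \<union> B \<union> (\<Union>p\<in>primes_in u v. D p)"
  proof
    fix n assume n: "n \<in> {1..v}"
    show "n \<in> A \<union> B \<union> (\<Union>p\<in>primes_in u v. D p)"
    proof (cases "\<exists>p\<in>primes_in u v. p dvd n")
      case True
      then show ?thesis using n by (auto simp: D_def)
    next
      case False
      have "smooth_part u n = n"
      proof (rule smooth_part_eq_self)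
        fix p assume p: "prime p" "p dvd n"
        then have "p \<le> v" using n by (auto dest: dvd_imp_le)
        then show "p \<le> u" using False p by (metis (mono_tags, lifting) mem_Collect_eq not_le primes_in_def)
      qed (use n in auto)
      then show ?thesis using n unfolding A_def B_def by (auto simp: field_simps)
    qed
  qed
  then have "card {1..v} \<le> card (A \<union> B \<union> (\<Union>p\<in>primes_in u v. D p))"
    by (rule card_mono[rotated]) (auto simp: A_def B_def D_def)
  also have "\<dots> \<le> card A + card B + card (\<Union>p\<in>primes_in u v. D p)"
    by (intro order_trans[OF card_Un_le] add_mono card_Un_le) auto
  also have "card (\<Union>p\<in>primes_in u v. D p) \<le> (\<Sum>p\<in>primes_in u v. card (D p))"
    by (rule card_UN_le) simp
  finally have "real v \<le> real (card A + card B + (\<Sum>p\<in>primes_in u v. card (D p)))"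
    unfolding of_nat_le_iff by simp
  also have "\<dots> = real (card A) + real (card B) + (\<Sum>p\<in>primes_in u v. real (card (D p)))"
    by simp
  also have "\<dots> \<le> real v / 4 + real v / 4 + (\<Sum>p\<in>primes_in u v. real v * (1 / real p))"
  proof (intro add_mono sum_mono)
    show "real (card A) \<le> real v / 4"
      using of_nat_div_le_of_nat[of v 4] by (simp add: A_def)
    have "real (card B) \<le> real v * (4 * (ln (real u) + 1) / ln (real v / 4))"
      unfolding B_def using u v4 by (intro card_large_smooth_part) auto
    also have "\<dots> \<le> real v * (1 / 4)"
    proof (intro mult_left_mono)
      have "0 < ln (real v / 4)" using lnv4 lnu by linarith
      then show "4 * (ln (real u) + 1) / ln (real v / 4) \<le> 1 / 4"
        using lnv4 lnu by (simp add: divide_le_eq)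
    qed simp
    finally show "real (card B) \<le> real v / 4" by simp
    fix p assume "p \<in> primes_in u v"
    then show "real (card (D p)) \<le> real v * (1 / real p)"
      using card_multiples_le[of p v] primes_inD(4)[of p u v] by (simp add: D_def)
  qed
  also have "\<dots> = real v * (1 / 2 + ?\<sigma>)"
    by (simp only: sum_distrib_left[symmetric] distrib_left)
  finally show ?thesis
    using v0 by simp
qed

lemma sum_inverse_primes_ge:
  assumes u: "u \<ge> 3"
  shows "(\<Sum>p\<in>primes_in u (u ^ (64 ^ m)). 1 / real p) \<ge> real m / 2"
proof (induction m)
  case (Suc m)
  let ?w = "u ^ (64 ^ m)"
  have w: "?w \<ge> u" using u by (simp add: self_le_power)
  have w': "u ^ (64 ^ Suc m) = ?w ^ 64" by (simp only: power_Suc power_mult[symmetric] mult.commute)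
  have "?w ^ 64 \<ge> ?w" using w u by (simp add: self_le_power)
  note split = primes_in_split[OF w this]
  have "(\<Sum>p\<in>primes_in u (?w ^ 64). 1 / real p) =
    (\<Sum>p\<in>primes_in u ?w. 1 / real p) + (\<Sum>p\<in>primes_in ?w (?w ^ 64). 1 / real p)"
    using split by (simp add: sum.union_disjoint)
  also have "\<dots> \<ge> real m / 2 + 1 / 2"
    using w u Suc by (intro add_mono sum_inverse_primes_ge_half) auto
  finally show ?case unfolding w' by (simp add: add_divide_distrib)
qed (simp add: sum_nonneg)

section \<open>Detecting integral subset sums with characters\<close>

definition recip_sum :: "nat set \<Rightarrow> real" where
  "recip_sum X = (\<Sum>n\<in>X. 1 / real n)"

definition misses :: "nat \<Rightarrow> nat set \<Rightarrow> int \<Rightarrow> nat set" where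
  "misses K C h = {n \<in> C. \<forall>x. int n dvd x \<longrightarrow> int K < \<bar>x - h\<bar>}"

lemma cos_le_exp:
  fixes x :: real
  assumes "\<bar>x\<bar> \<le> pi / 2"
  shows "\<bar>cos x\<bar> \<le> exp (- (x\<^sup>2 / 3))"
proof -
  have *: "\<bar>cos x\<bar> \<le> exp (- (x\<^sup>2 / 3))" if x: "0 < x" "x \<le> pi / 2" for x :: real
  proof -
    \<comment> \<open>Taylor expansion of order 4; the remainder is absorbed because \<open>x \<le> \<pi>/2 < 2\<close>.\<close>
    obtain t where "cos x = (\<Sum>m<4. cos_coeff m * x ^ m) + (cos (t + 1/2 * real 4 * pi) / fact 4) * x ^ 4"
      using Maclaurin_cos_expansion2[OF x(1), of 4] by auto
    moreover have "cos_coeff 0 = 1" "cos_coeff 1 = 0" "cos_coeff 2 = - 1 / 2" "cos_coeff 3 = 0"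
      by (simp_all add: cos_coeff_def)
    moreover have "{..<4} = {0, 1, 2, 3 :: nat}" by auto
    ultimately have "cos x = 1 - x\<^sup>2 / 2 + (cos (t + 2 * pi) / 24) * x ^ 4"
      by (simp add: fact_numeral)
    also have "\<dots> \<le> 1 - x\<^sup>2 / 2 + (1 / 24) * x ^ 4"
      by (intro add_left_mono mult_right_mono divide_right_mono) auto
    also have "\<dots> \<le> 1 - x\<^sup>2 / 2 + (1 / 24) * (4 * x\<^sup>2)"
    proof -
      have "x \<le> 2" using x pi_less_4 by linarith
      then have "x\<^sup>2 \<le> 2\<^sup>2" using x by (intro power_mono) auto
      then have "x\<^sup>2 * x\<^sup>2 \<le> 4 * x\<^sup>2" by (intro mult_right_mono) auto
      then show ?thesis by (simp add: power4_eq_xxxx power2_eq_square mult_ac)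
    qed
    also have "\<dots> = 1 + (- (x\<^sup>2 / 3))" by simp
    also have "\<dots> \<le> exp (- (x\<^sup>2 / 3))" by (rule exp_ge_add_one_self)
    finally show ?thesis using x cos_ge_zero[of x] by simp
  qed
  consider "x = 0" | "x > 0" | "- x > 0" by linarith
  then show ?thesis
  proof cases
    case 3
    then show ?thesis using *[of "- x"] assms by simp
  qed (use * assms in auto)
qed

text \<open>
If \<open>h\<close> is farther than \<open>K\<close> from all multiples of \<open>n\<close>, then \<open>h / n\<close> is farther than \<open>K / n\<close> from all integers, and
the cosine is bounded away from 1 accordingly.
\<close>

lemma cos_miss_le:
  assumes n: "n > 0" and far: "\<And>x. int n dvd x \<Longrightarrow> int K < \<bar>x - h\<bar>"
  shows "\<bar>cos (pi * real_of_int h / real n)\<bar> \<le> exp (- (real K / real n)\<^sup>2)"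
proof -
  define m where "m = round (real_of_int h / real n)"
  define \<phi> where "\<phi> = pi * (real_of_int h / real n - real_of_int m)"
  have "\<bar>real_of_int h / real n - real_of_int m\<bar> \<le> 1 / 2"
    unfolding m_def using of_int_round_abs_le[of "real_of_int h / real n"] by (simp add: abs_minus_commute)
  then have "\<bar>\<phi>\<bar> \<le> pi * (1 / 2)"
    unfolding \<phi>_def abs_mult by (intro mult_mono) auto
  then have cos: "\<bar>cos \<phi>\<bar> \<le> exp (- (\<phi>\<^sup>2 / 3))"
    by (intro cos_le_exp) auto
  have "int K < \<bar>int n * m - h\<bar>" by (intro far) auto
  then have "real_of_int (int K) < real_of_int \<bar>int n * m - h\<bar>" by (simp only: of_int_less_iff)
  then have "real K \<le> \<bar>real n * real_of_int m - real_of_int h\<bar>" by simp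
  also have "\<dots> = real n * \<bar>real_of_int h / real n - real_of_int m\<bar>"
    using n by (simp add: abs_if field_simps)
  finally have "real K / real n \<le> \<bar>real_of_int h / real n - real_of_int m\<bar>"
    using n by (simp add: field_simps)
  then have "2 * (real K / real n) \<le> \<bar>\<phi>\<bar>"
    unfolding \<phi>_def abs_mult using pi_ge_two by (intro mult_mono) auto
  then have "(2 * (real K / real n))\<^sup>2 \<le> \<bar>\<phi>\<bar>\<^sup>2"
    by (intro power_mono) auto
  then have "4 * (real K / real n)\<^sup>2 \<le> \<phi>\<^sup>2"
    by (simp only: power_mult_distrib power2_abs) simp
  then have "(real K / real n)\<^sup>2 \<le> \<phi>\<^sup>2 / 3"
    using zero_le_power2[of "real K / real n"] by linarith
  then have "exp (- (\<phi>\<^sup>2 / 3)) \<le> exp (- (real K / real n)\<^sup>2)" by simp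
  moreover have "\<bar>cos (pi * real_of_int h / real n)\<bar> = \<bar>cos \<phi>\<bar>"
  proof -
    have eq: "pi * real_of_int h / real n = \<phi> + real_of_int m * pi"
      unfolding \<phi>_def by (simp add: algebra_simps)
    have "sin (real_of_int m * pi) = 0" by (simp add: sin_zero_iff_int2)
    moreover from this have "\<bar>cos (real_of_int m * pi)\<bar> = 1"
      using sin_cos_squared_add[of "real_of_int m * pi"] by (simp add: abs_square_eq_1)
    ultimately show ?thesis unfolding eq cos_add by (simp add: abs_mult)
  qed
  ultimately show ?thesis using cos by linarith
qed

lemma prod_cos_le_misses:
  assumes "finite C" "\<And>n. n \<in> C \<Longrightarrow> 0 < n \<and> n \<le> N"
  shows "(\<Prod>n\<in>C. \<bar>cos (pi * real_of_int h / real n)\<bar>) \<le>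
    exp (- (real K / real N)\<^sup>2 * real (card (misses K C h)))"
proof -
  let ?F = "misses K C h"
  have sub: "?F \<subseteq> C" by (auto simp: misses_def)
  have "(\<Prod>n\<in>C. \<bar>cos (pi * real_of_int h / real n)\<bar>) =
    (\<Prod>n\<in>C - ?F. \<bar>cos (pi * real_of_int h / real n)\<bar>) * (\<Prod>n\<in>?F. \<bar>cos (pi * real_of_int h / real n)\<bar>)"
    by (rule prod.subset_diff[OF sub assms(1)])
  also have "\<dots> \<le> 1 * (\<Prod>n\<in>?F. exp (- (real K / real N)\<^sup>2))"
  proof (intro mult_mono prod_mono prod_le_1 conjI)
    fix n assume n: "n \<in> ?F"
    then have n0: "0 < n" "n \<le> N" using assms sub by auto
    have "\<bar>cos (pi * real_of_int h / real n)\<bar> \<le> exp (- (real K / real n)\<^sup>2)"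
      using n n0 by (intro cos_miss_le) (auto simp: misses_def)
    also have "\<dots> \<le> exp (- (real K / real N)\<^sup>2)"
      using n0 by (auto intro!: power_mono divide_left_mono)
    finally show "\<bar>cos (pi * real_of_int h / real n)\<bar> \<le> exp (- (real K / real N)\<^sup>2)" .
  qed (auto intro!: prod_nonneg)
  also have "\<dots> = exp (- (real K / real N)\<^sup>2 * real (card ?F))"
    by (simp add: exp_of_nat_mult[symmetric] mult.commute)
  finally show ?thesis .
qed

lemma one_plus_cis: "1 + cis (2 * a) = of_real (2 * cos a) * cis a"
  by (simp add: complex_eq_iff cos_double_cos sin_double power2_eq_square)

lemma prod_cis: "(\<Prod>n\<in>S. cis (f n)) = cis (\<Sum>n\<in>S. f n)"
  by (induction S rule: infinite_finite_induct) (auto simp: cis_mult)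

text \<open>
Orthogonality of characters: a nontrivial \<open>P\<close>-th root of unity has vanishing power sum.
\<close>

lemma sum_cis_eq_0:
  assumes P: "P > 0" and int: "\<gamma> * real P \<in> \<int>" and nint: "\<gamma> \<notin> \<int>"
  shows "(\<Sum>h<P. cis (2 * pi * (real h * \<gamma>))) = 0"
proof -
  let ?z = "cis (2 * pi * \<gamma>)"
  have "?z \<noteq> 1"
  proof
    assume "?z = 1"
    then have "cos (2 * pi * \<gamma>) = 1" by (simp add: complex_eq_iff)
    then obtain k :: int where "2 * pi * \<gamma> = real_of_int k * 2 * pi" by (auto simp: cos_one_2pi_int)
    then have "\<gamma> = real_of_int k" by simp
    then show False using nint by simp
  qed
  moreover have "?z ^ P = 1"
    using cis_multiple_2pi[OF int] by (simp add: DeMoivre mult_ac)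
  ultimately have "(\<Sum>h<P. ?z ^ h) = 0" by (simp add: geometric_sum)
  then show ?thesis by (simp add: DeMoivre mult_ac)
qed

text \<open>
The circle method in the form needed here. Were no sum \<open>\<beta> + R(S)\<close> integral, then the sum over all
frequencies \<open>h\<close> of \<open>e(h \<beta>) \<Prod>\<^sub>n (1 + e(h/n))\<close> would vanish by orthogonality. But the frequency 0
contributes \<open>2 ^ |C|\<close>, the frequencies near multiples of \<open>P\<close> have nonnegative real part, and by assumption
the remaining ones are too small to compensate. The real part is controlled by writing
\<open>1 + e(2a) = 2 cos a e(a)\<close>, which turns the phase of the term into that of \<open>h (\<beta> + R(C)/2)\<close>; as \<open>h\<close> is an
integer, only the distance of \<open>\<beta> + R(C)/2\<close> from 1 counts.
\<close>

lemma exists_integer_subsum: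
  assumes fin: "finite C" and C: "\<And>n. n \<in> C \<Longrightarrow> 0 < n \<and> n dvd P" and P: "P > 0"
    and beta: "\<beta> * real P \<in> \<int>"
    and K: "\<And>n. n \<in> C \<Longrightarrow> 2 * K \<le> n" and near: "\<bar>\<beta> + recip_sum C / 2 - 1\<bar> * real K \<le> 1 / 4"
    and minor: "(\<Sum>h\<in>{h. h < P \<and> \<not> (\<exists>x. int P dvd x \<and> \<bar>x - int h\<bar> \<le> int K)}.
                  \<Prod>n\<in>C. \<bar>cos (pi * real h / real n)\<bar>) < 1"
  shows "\<exists>S\<subseteq>C. \<beta> + recip_sum S \<in> \<int>"
proof (rule ccontr)
  assume none: "\<not> (\<exists>S\<subseteq>C. \<beta> + recip_sum S \<in> \<int>)"
  \<comment> \<open>The generating function of the sums, evaluated at frequency \<open>h\<close>.\<close>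
  define f where "f h = cis (2 * pi * (real_of_int h * \<beta>)) * (\<Prod>n\<in>C. 1 + cis (2 * pi * (real_of_int h / real n)))" for h :: int
  have f_expand: "f h = (\<Sum>S\<in>Pow C. cis (2 * pi * (real_of_int h * (\<beta> + recip_sum S))))" for h
  proof -
    have "(\<Prod>n\<in>C. 1 + cis (2 * pi * (real_of_int h / real n))) =
      (\<Prod>n\<in>C. cis (2 * pi * (real_of_int h / real n)) + 1)" by (simp add: add.commute)
    also have "\<dots> = (\<Sum>S\<in>Pow C. cis (2 * pi * (real_of_int h * recip_sum S)))"
      by (subst prod_add[OF fin], intro sum.cong refl)
        (simp add: prod_cis recip_sum_def sum_distrib_left)
    finally show ?thesis
      unfolding f_def by (simp add: sum_distrib_left cis_mult ring_distribs)
  qed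
  have f_polar: "f h = of_real (2 ^ card C * (\<Prod>n\<in>C. cos (pi * real_of_int h / real n))) *
     cis (2 * pi * (real_of_int h * (\<beta> + recip_sum C / 2)))" for h
  proof -
    have "(\<Prod>n\<in>C. 1 + cis (2 * pi * (real_of_int h / real n))) =
      (\<Prod>n\<in>C. of_real (2 * cos (pi * real_of_int h / real n)) * cis (pi * real_of_int h / real n))"
      by (intro prod.cong refl) (metis (no_types, lifting) one_plus_cis mult.assoc times_divide_eq_right)
    also have "\<dots> = of_real (2 ^ card C * (\<Prod>n\<in>C. cos (pi * real_of_int h / real n))) *
        cis (\<Sum>n\<in>C. pi * real_of_int h / real n)"
      by (simp add: prod.distrib prod_cis)
    also have "(\<Sum>n\<in>C. pi * real_of_int h / real n) = 2 * pi * (real_of_int h * (recip_sum C / 2))"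
      unfolding recip_sum_def sum_divide_distrib sum_distrib_left by (intro sum.cong) auto
    finally show ?thesis
      unfolding f_def by (simp add: cis_mult ring_distribs)
  qed
  have sum0: "(\<Sum>h<P. f (int h)) = 0"
  proof -
    have "(\<Sum>h<P. f (int h)) = (\<Sum>S\<in>Pow C. \<Sum>h<P. cis (2 * pi * (real h * (\<beta> + recip_sum S))))"
      unfolding f_expand by (subst sum.swap) simp
    also have "\<dots> = 0"
    proof (rule sum.neutral, rule ballI)
      fix S assume S: "S \<in> Pow C"
      have "recip_sum S * real P = (\<Sum>n\<in>S. real P / real n)"
        by (simp add: recip_sum_def sum_distrib_right)
      also have "\<dots> \<in> \<int>"
        using S C by (intro Ints_sum) (auto simp: real_of_nat_div[symmetric])
      finally have "(\<beta> + recip_sum S) * real P \<in> \<int>"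
        using beta by (simp add: ring_distribs)
      then show "(\<Sum>h<P. cis (2 * pi * (real h * (\<beta> + recip_sum S)))) = 0"
        using none S P by (intro sum_cis_eq_0) auto
    qed
    finally show ?thesis .
  qed
  have periodic: "f (h + int P * m) = f h" for h m
  proof -
    have "cis (2 * pi * (real_of_int (h + int P * m) * (\<beta> + recip_sum S))) =
        cis (2 * pi * (real_of_int h * (\<beta> + recip_sum S)))" if S: "S \<in> Pow C" for S
    proof -
      have "recip_sum S * real P = (\<Sum>n\<in>S. real P / real n)"
        by (simp add: recip_sum_def sum_distrib_right)
      also have "\<dots> \<in> \<int>"
        using S C by (intro Ints_sum) (auto simp: real_of_nat_div[symmetric])
      finally have "(\<beta> + recip_sum S) * real P \<in> \<int>"
        using beta by (simp add: ring_distribs)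
      then have "real_of_int m * ((\<beta> + recip_sum S) * real P) \<in> \<int>" by simp
      then have "cis (2 * pi * (real_of_int m * ((\<beta> + recip_sum S) * real P))) = 1"
        by (rule cis_multiple_2pi)
      moreover have "cis (2 * pi * (real_of_int (h + int P * m) * (\<beta> + recip_sum S))) =
         cis (2 * pi * (real_of_int h * (\<beta> + recip_sum S))) * cis (2 * pi * (real_of_int m * ((\<beta> + recip_sum S) * real P)))"
        unfolding cis_mult by (simp add: algebra_simps)
      ultimately show ?thesis by simp
    qed
    then show ?thesis unfolding f_expand by (intro sum.cong) auto
  qed
  have norm_f: "norm (f h) = 2 ^ card C * (\<Prod>n\<in>C. \<bar>cos (pi * real_of_int h / real n)\<bar>)" for h
    unfolding f_polar norm_mult norm_of_real by (simp add: abs_mult abs_prod)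
  have major: "Re (f h) \<ge> 0" if x: "int P dvd x" "\<bar>x - h\<bar> \<le> int K" for x h
  proof -
    obtain m where m: "x = int P * m" using x by (elim dvdE)
    define j where "j = h - x"
    have j: "\<bar>j\<bar> \<le> int K" using x by (simp add: j_def abs_minus_commute)
    have "f h = f j" using periodic[of j m] by (simp add: j_def m)
    also have "f j = of_real (2 ^ card C * (\<Prod>n\<in>C. cos (pi * real_of_int j / real n))) *
      cis (2 * pi * (real_of_int j * (\<beta> + recip_sum C / 2 - 1)))"
    proof -
      have "cis (2 * pi * real_of_int j) = 1" by (rule cis_multiple_2pi) simp
      then have "cis (2 * pi * (real_of_int j * (\<beta> + recip_sum C / 2))) =
        cis (2 * pi * (real_of_int j * (\<beta> + recip_sum C / 2 - 1)))"
        by (simp add: right_diff_distrib cis_divide[symmetric])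
      then show ?thesis unfolding f_polar by simp
    qed
    finally have "Re (f h) = 2 ^ card C * (\<Prod>n\<in>C. cos (pi * real_of_int j / real n)) *
       cos (2 * pi * (real_of_int j * (\<beta> + recip_sum C / 2 - 1)))"
      by (simp only: Re_complex_of_real Im_complex_of_real times_complex.sel cis.sel)
    also have "\<dots> \<ge> 0"
    proof (intro mult_nonneg_nonneg prod_nonneg)
      fix n assume n: "n \<in> C"
      have "\<bar>pi * real_of_int j / real n\<bar> = pi * (\<bar>real_of_int j\<bar> / real n)" by (simp add: abs_mult)
      also have "\<dots> \<le> pi * (1 / 2)"
      proof (intro mult_left_mono)
        have "\<bar>real_of_int j\<bar> \<le> real K" using j by linarith
        then have "2 * \<bar>real_of_int j\<bar> \<le> real n" using K[OF n] by linarith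
        then show "\<bar>real_of_int j\<bar> / real n \<le> 1 / 2" using C[OF n] by (simp add: field_simps)
      qed auto
      finally have "\<bar>pi * real_of_int j / real n\<bar> \<le> pi / 2" by simp
      then show "cos (pi * real_of_int j / real n) \<ge> 0" by (intro cos_ge_zero) linarith+
    next
      have "\<bar>real_of_int j\<bar> * \<bar>\<beta> + recip_sum C / 2 - 1\<bar> \<le> real K * \<bar>\<beta> + recip_sum C / 2 - 1\<bar>"
        using j by (intro mult_right_mono) linarith+
      also have "\<dots> \<le> 1 / 4" using near by (simp add: mult.commute)
      finally have "2 * pi * \<bar>real_of_int j * (\<beta> + recip_sum C / 2 - 1)\<bar> \<le> 2 * pi * (1 / 4)"
        by (intro mult_left_mono) (auto simp: abs_mult)
      then have "\<bar>2 * pi * (real_of_int j * (\<beta> + recip_sum C / 2 - 1))\<bar> \<le> pi / 2"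
        by (simp add: abs_mult)
      then show "cos (2 * pi * (real_of_int j * (\<beta> + recip_sum C / 2 - 1))) \<ge> 0"
        by (intro cos_ge_zero) linarith+
    qed simp
    finally show ?thesis .
  qed
  define Mi where "Mi = {h. h < P \<and> \<not> (\<exists>x. int P dvd x \<and> \<bar>x - int h\<bar> \<le> int K)}"
  have Mi: "Mi \<subseteq> {..<P} - {0}" using P by (auto simp: Mi_def)
  then have finMi: "finite Mi" by (rule finite_subset) simp
  have "norm (\<Sum>h\<in>Mi. f (int h)) \<le> (\<Sum>h\<in>Mi. norm (f (int h)))" by (rule norm_sum)
  also have "\<dots> = 2 ^ card C * (\<Sum>h\<in>Mi. \<Prod>n\<in>C. \<bar>cos (pi * real h / real n)\<bar>)"
    unfolding norm_f by (simp add: sum_distrib_left)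
  also have "\<dots> < 2 ^ card C * 1"
    using minor unfolding Mi_def by (intro mult_strict_left_mono) auto
  finally have small: "norm (\<Sum>h\<in>Mi. f (int h)) < 2 ^ card C" by simp
  have "(\<Sum>h<P. f (int h)) = (\<Sum>h\<in>{..<P} - Mi. f (int h)) + (\<Sum>h\<in>Mi. f (int h))"
    using Mi by (intro sum.subset_diff) auto
  also have "(\<Sum>h\<in>{..<P} - Mi. f (int h)) = f 0 + (\<Sum>h\<in>{..<P} - Mi - {0}. f (int h))"
    using Mi P by (subst sum.remove[of _ 0]) auto
  also have "f 0 = of_nat (2 ^ card C)" by (simp add: f_def)
  finally have "0 = Re (of_nat (2 ^ card C) + (\<Sum>h\<in>{..<P} - Mi - {0}. f (int h)) + (\<Sum>h\<in>Mi. f (int h)))"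
    using sum0 by simp
  also have "\<dots> = 2 ^ card C + (\<Sum>h\<in>{..<P} - Mi - {0}. Re (f (int h))) + Re (\<Sum>h\<in>Mi. f (int h))"
    by simp
  finally have "Re (\<Sum>h\<in>Mi. f (int h)) = - (2 ^ card C + (\<Sum>h\<in>{..<P} - Mi - {0}. Re (f (int h))))"
    by linarith
  moreover have "(\<Sum>h\<in>{..<P} - Mi - {0}. Re (f (int h))) \<ge> 0"
    using major by (intro sum_nonneg) (auto simp: Mi_def)
  ultimately have "2 ^ card C \<le> \<bar>Re (\<Sum>h\<in>Mi. f (int h))\<bar>" by linarith
  also have "\<dots> \<le> norm (\<Sum>h\<in>Mi. f (int h))" by (rule abs_Re_le_cmod)
  finally show False using small by linarith
qed

section \<open>Counting minor frequencies\<close>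

text \<open>
The quotients \<open>(h + j) W / P\<close> are distinct integers in an interval of length \<open>W\<close>.
\<close>

lemma card_scaled_multiples_le:
  assumes "P > 0" "W > 0"
  shows "card {h. h < P \<and> int P dvd (int h + j) * int W} \<le> 2 * W"
proof -
  let ?H = "{h. h < P \<and> int P dvd (int h + j) * int W}"
  let ?f = "\<lambda>h. (int h + j) * int W div int P"
  let ?a = "j * int W div int P"
  have "inj_on ?f ?H"
  proof (rule inj_onI)
    fix h h' assume h: "h \<in> ?H" "h' \<in> ?H" "?f h = ?f h'"
    then have "(int h + j) * int W = (int h' + j) * int W"
      by (metis (mono_tags, lifting) dvd_div_mult_self mem_Collect_eq)
    then show "h = h'" using assms by simp
  qed
  moreover have "?f ` ?H \<subseteq> {?a..?a + int W}"
  proof (rule image_subsetI)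
    fix h assume h: "h \<in> ?H"
    have "j * int W div int P \<le> (int h + j) * int W div int P"
      using assms by (intro zdiv_mono1) (auto simp: algebra_simps)
    moreover have "(int h + j) * int W div int P \<le> (j * int W + int W * int P) div int P"
      using h assms by (intro zdiv_mono1) (auto simp: algebra_simps intro!: mult_left_mono)
    moreover have "(j * int W + int W * int P) div int P = ?a + int W"
      using assms by simp
    ultimately show "?f h \<in> {?a..?a + int W}" by simp
  qed
  ultimately have "card ?H \<le> card {?a..?a + int W}"
    by (intro card_inj_on_le) auto
  also have "\<dots> \<le> 2 * W" using assms by simp
  finally show ?thesis .
qed

lemma card_near_scaled_multiples_le:
  assumes "P > 0" "W > 0"
  shows "card {h. h < P \<and> (\<exists>x. \<bar>x - int h\<bar> \<le> int K \<and> int P dvd x * int W)} \<le> (2 * K + 1) * (2 * W)"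
proof -
  let ?E = "\<lambda>j. {h. h < P \<and> int P dvd (int h + j) * int W}"
  have "{h. h < P \<and> (\<exists>x. \<bar>x - int h\<bar> \<le> int K \<and> int P dvd x * int W)} \<subseteq> (\<Union>j\<in>{- int K..int K}. ?E j)"
  proof
    fix h assume "h \<in> {h. h < P \<and> (\<exists>x. \<bar>x - int h\<bar> \<le> int K \<and> int P dvd x * int W)}"
    then obtain x where "h < P" "\<bar>x - int h\<bar> \<le> int K" "int P dvd x * int W" by blast
    then have "x - int h \<in> {- int K..int K}" "h \<in> ?E (x - int h)" by auto
    then show "h \<in> (\<Union>j\<in>{- int K..int K}. ?E j)" by blast
  qed
  then have "card {h. h < P \<and> (\<exists>x. \<bar>x - int h\<bar> \<le> int K \<and> int P dvd x * int W)} \<le> card (\<Union>j\<in>{- int K..int K}. ?E j)"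
    by (rule card_mono[rotated]) auto
  also have "\<dots> \<le> (\<Sum>j\<in>{- int K..int K}. card (?E j))"
    by (rule card_UN_le) simp
  also have "\<dots> \<le> (\<Sum>j\<in>{- int K..int K}. 2 * W)"
    using assms by (intro sum_mono card_scaled_multiples_le)
  also have "\<dots> = (2 * K + 1) * (2 * W)"
  proof -
    have "card {- int K..int K} = 2 * K + 1" by simp
    then show ?thesis by (simp only: sum_constant of_nat_id)
  qed
  finally show ?thesis .
qed

text \<open>
Each frequency that is not near a multiple of \<open>P\<close> either misses \<open>F\<close> elements, or is near an integer that
becomes a multiple of \<open>P\<close> after multiplication by the primes of a nonempty set \<open>U\<close>. There are at most
\<open>2 (2K + 1) N ^ |U|\<close> frequencies of the second kind for a given \<open>U\<close>, each of size at most
\<open>exp (- (K/N)\<^sup>2 t |U|)\<close>. Summing over all nonempty \<open>U\<close> with the binomial theorem gives the second term.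
\<close>

lemma minor_arcs_sum_le:
  fixes F t :: real
  assumes finC: "finite C" and C: "\<And>n. n \<in> C \<Longrightarrow> 0 < n \<and> n \<le> N" and P: "P > 0"
    and finQ: "finite Q" and Q: "\<And>q. q \<in> Q \<Longrightarrow> 0 < q \<and> q \<le> N"
    and dich: "\<And>h. h < P \<Longrightarrow> F \<le> real (card (misses K C (int h))) \<or>
       (\<exists>x U. \<bar>x - int h\<bar> \<le> int K \<and> U \<subseteq> Q \<and> int P dvd x * int (\<Prod>U) \<and>
               t * real (card U) \<le> real (card (misses K C (int h))))"
  shows "(\<Sum>h\<in>{h. h < P \<and> \<not> (\<exists>x. int P dvd x \<and> \<bar>x - int h\<bar> \<le> int K)}.
            \<Prod>n\<in>C. \<bar>cos (pi * real h / real n)\<bar>)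
     \<le> real P * exp (- (real K / real N)\<^sup>2 * F) +
        real (2 * (2 * K + 1)) * ((1 + real N * exp (- (real K / real N)\<^sup>2 * t)) ^ card Q - 1)"
proof -
  define Mi where "Mi = {h. h < P \<and> \<not> (\<exists>x. int P dvd x \<and> \<bar>x - int h\<bar> \<le> int K)}"
  define k where "k = (real K / real N)\<^sup>2"
  have k0: "k \<ge> 0" by (simp add: k_def)
  define E where "E U = {h. h < P \<and> (\<exists>x. \<bar>x - int h\<bar> \<le> int K \<and> int P dvd x * int (\<Prod>U))}" for U
  let ?PQ = "Pow Q - {{}}"
  let ?c = "real N * exp (- k * t)"
  have finPQ: "finite ?PQ" using finQ by simp
  have finMi: "finite Mi" by (rule finite_subset[of _ "{..<P}"]) (auto simp: Mi_def)
  have "(\<Sum>h\<in>Mi. \<Prod>n\<in>C. \<bar>cos (pi * real h / real n)\<bar>) \<le>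
    (\<Sum>h\<in>Mi. exp (- k * F) + (\<Sum>U\<in>?PQ. of_bool (h \<in> E U) * exp (- k * t) ^ card U))"
  proof (rule sum_mono)
    fix h assume h: "h \<in> Mi"
    let ?m = "real (card (misses K C (int h)))"
    have le: "(\<Prod>n\<in>C. \<bar>cos (pi * real h / real n)\<bar>) \<le> exp (- k * ?m)"
      using prod_cos_le_misses[OF finC C, of "int h" K] by (simp add: k_def)
    have nonneg: "(\<Sum>U\<in>?PQ. of_bool (h \<in> E U) * exp (- k * t) ^ card U) \<ge> 0"
      by (intro sum_nonneg) auto
    have "h < P" using h by (simp add: Mi_def)
    from dich[OF this] show "(\<Prod>n\<in>C. \<bar>cos (pi * real h / real n)\<bar>) \<le>
       exp (- k * F) + (\<Sum>U\<in>?PQ. of_bool (h \<in> E U) * exp (- k * t) ^ card U)"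
    proof (elim disjE exE conjE)
      assume "F \<le> ?m"
      then have "exp (- k * ?m) \<le> exp (- k * F)" using k0 by (simp add: mult_left_mono)
      then show ?thesis using le nonneg by linarith
    next
      fix x U
      assume xU: "\<bar>x - int h\<bar> \<le> int K" "U \<subseteq> Q" "int P dvd x * int (\<Prod>U)" "t * real (card U) \<le> ?m"
      have "U \<noteq> {}"
      proof
        assume "U = {}"
        then show False using xU h by (auto simp: Mi_def)
      qed
      then have U: "U \<in> ?PQ" using xU by auto
      have hE: "h \<in> E U" using xU \<open>h < P\<close> by (auto simp: E_def)
      have "exp (- k * ?m) \<le> exp (- k * (t * real (card U)))"
        using k0 xU by (simp add: mult_left_mono)
      also have "\<dots> = exp (- k * t) ^ card U"
        by (simp add: exp_of_nat_mult[symmetric] mult_ac)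
      also have "\<dots> = of_bool (h \<in> E U) * exp (- k * t) ^ card U" using hE by simp
      also have "\<dots> \<le> (\<Sum>U\<in>?PQ. of_bool (h \<in> E U) * exp (- k * t) ^ card U)"
        using U finPQ by (intro member_le_sum) auto
      finally show ?thesis using le exp_gt_zero[of "- k * F"] by linarith
    qed
  qed
  also have "\<dots> = real (card Mi) * exp (- k * F) + (\<Sum>U\<in>?PQ. (\<Sum>h\<in>Mi. of_bool (h \<in> E U)) * exp (- k * t) ^ card U)"
  proof -
    have "(\<Sum>h\<in>Mi. \<Sum>U\<in>?PQ. of_bool (h \<in> E U) * exp (- k * t) ^ card U) =
      (\<Sum>U\<in>?PQ. \<Sum>h\<in>Mi. of_bool (h \<in> E U) * exp (- k * t) ^ card U)"
      by (rule sum.swap)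
    then show ?thesis by (simp only: sum.distrib sum_distrib_right sum_constant)
  qed
  also have "\<dots> \<le> real P * exp (- k * F) + (\<Sum>U\<in>?PQ. real (2 * (2 * K + 1)) * ?c ^ card U)"
  proof (intro add_mono mult_right_mono sum_mono)
    have "card Mi \<le> card {..<P}" by (rule card_mono) (auto simp: Mi_def)
    then show "real (card Mi) \<le> real P" by simp
  next
    fix U assume U: "U \<in> ?PQ"
    have W0: "\<Prod>U > 0" using U Q by (intro prod_pos) auto
    have "card (Mi \<inter> E U) \<le> card (E U)"
      by (rule card_mono) (auto simp: E_def)
    also have "card (E U) \<le> (2 * K + 1) * (2 * \<Prod>U)"
      unfolding E_def by (intro card_near_scaled_multiples_le P W0)
    also have "\<dots> = 2 * (2 * K + 1) * \<Prod>U" by simp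
    finally have "real (card (Mi \<inter> E U)) \<le> real (2 * (2 * K + 1) * \<Prod>U)"
      by (simp only: of_nat_le_iff)
    also have "\<dots> = real (2 * (2 * K + 1)) * real (\<Prod>U)"
      by (rule of_nat_mult)
    also have "real (\<Prod>U) \<le> real N ^ card U"
    proof -
      have "(\<Prod>q\<in>U. real q) \<le> (\<Prod>q\<in>U. real N)"
        using U Q by (intro prod_mono) auto
      then show ?thesis by simp
    qed
    finally have card_le: "real (card (Mi \<inter> E U)) \<le> real (2 * (2 * K + 1)) * real N ^ card U"
      by (simp add: mult_left_mono)
    have "(\<Sum>h\<in>Mi. of_bool (h \<in> E U)) = real (card (Mi \<inter> E U))"
      using finMi by (simp add: of_bool_def sum.If_cases Int_def)
    then have "(\<Sum>h\<in>Mi. of_bool (h \<in> E U)) * exp (- k * t) ^ card U \<le>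
       real (2 * (2 * K + 1)) * real N ^ card U * exp (- k * t) ^ card U"
      using card_le by (intro mult_right_mono) (auto intro: zero_le_power)
    then show "(\<Sum>h\<in>Mi. of_bool (h \<in> E U)) * exp (- k * t) ^ card U \<le> real (2 * (2 * K + 1)) * ?c ^ card U"
      by (simp only: power_mult_distrib mult.assoc)
  qed auto
  also have "(\<Sum>U\<in>?PQ. real (2 * (2 * K + 1)) * ?c ^ card U) = real (2 * (2 * K + 1)) * ((\<Sum>U\<in>Pow Q. ?c ^ card U) - 1)"
  proof -
    have "(\<Sum>U\<in>Pow Q. ?c ^ card U) = 1 + (\<Sum>U\<in>?PQ. ?c ^ card U)"
      using sum.remove[of "Pow Q" "{}" "\<lambda>U. ?c ^ card U"] finQ by simp
    then have "(\<Sum>U\<in>Pow Q. ?c ^ card U) - 1 = (\<Sum>U\<in>?PQ. ?c ^ card U)" by linarith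
    then show ?thesis by (simp only: sum_distrib_left)
  qed
  also have "(\<Sum>U\<in>Pow Q. ?c ^ card U) = (?c + 1) ^ card Q"
    using prod_add[OF finQ, of "\<lambda>_. ?c" "\<lambda>_. 1"] by simp
  finally show ?thesis unfolding Mi_def k_def by (simp add: add.commute)
qed

section \<open>Frequencies met by a rich family\<close>

lemma sum_Un_le:
  fixes f :: "'a \<Rightarrow> real"
  assumes "finite A" "finite B" "\<And>x. f x \<ge> 0"
  shows "sum f (A \<union> B) \<le> sum f A + sum f B"
proof -
  have "sum f (A \<inter> B) \<ge> 0" using assms by (intro sum_nonneg)
  then show ?thesis using sum_Un[OF assms(1,2), of f] by linarith
qed

lemma window_unique:
  assumes g: "2 * K < g" and x: "int g dvd x" "\<bar>x - h\<bar> \<le> int K" and x': "int g dvd x'" "\<bar>x' - h\<bar> \<le> int K"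
  shows "x = x'"
proof (rule ccontr)
  assume "x \<noteq> x'"
  moreover have "int g dvd x - x'" using x x' by simp
  ultimately have "int g \<le> \<bar>x - x'\<bar>"
    using dvd_imp_le_int[of "x - x'" "int g"] by simp
  then show False using x x' g by linarith
qed

text \<open>
The set \<open>A\<close> supplies the least common multiple, and \<open>C\<close> consists of the elements that are included at
random. The assumptions called rich say that any prime above \<open>y\<close> and any smooth part that occurs in \<open>A\<close>
occurs often in \<open>C\<close>.

The number \<open>2 ^ L\<close> exceeds \<open>N\<close>, so an integer of size at most \<open>N\<close> has at most \<open>L\<close> prime factors. In
particular the primes between \<open>L\<close> and \<open>y1\<close> that divide a given nonzero integer of this size have
reciprocal sum at most 1, whereas all primes in this range together have reciprocal sum above \<open>2 \<mu> + 1\<close>.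
The lower bound \<open>y1\<close> for the smooth parts leaves room for the sieve with these primes. The number \<open>F\<close> is
the threshold between many and few misses.
\<close>

locale rich_family =
  fixes N y y1 K L Z :: nat and A C :: "nat set" and \<eta> \<mu> F T :: real
  assumes A_range: "A \<subseteq> {1..N}"
    and C_subset: "C \<subseteq> A"
    and smooth_ge: "\<And>n. n \<in> A \<Longrightarrow> y1 \<le> smooth_part y n"
    and rough_gt: "\<And>n. n \<in> A \<Longrightarrow> 2 * K < rough_part y n"
    and rough_squarefree: "\<And>n p. n \<in> A \<Longrightarrow> prime p \<Longrightarrow> y < p \<Longrightarrow> \<not> p\<^sup>2 dvd n"
    and prime_le: "\<And>n p. n \<in> A \<Longrightarrow> prime p \<Longrightarrow> p dvd n \<Longrightarrow> p \<le> Z"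
    and rich_prime: "\<And>n p. n \<in> A \<Longrightarrow> prime p \<Longrightarrow> y < p \<Longrightarrow> p dvd n \<Longrightarrow>
        \<eta> * real N / real p \<le> real (card {m \<in> C. p dvd m})"
    and rich_smooth: "\<And>n. n \<in> A \<Longrightarrow> T \<le> real (card {m \<in> C. smooth_part y m = smooth_part y n})"
    and N_bound: "N < 2 ^ L" and K_bound: "2 * K \<le> N" and K_pos: "K > 0" and L_pos: "L > 0" and Z_pos: "Z > 0"
    and eta_pos: "\<eta> > 0" and mu_pos: "\<mu> > 0"
    and mu_bound: "2 * \<mu> + 1 < (\<Sum>r\<in>primes_in L y1. 1 / real r)"
    and eta_mu: "6 * (\<Prod>p\<in>primes_in y N. 1 + 1 / real p) \<le> \<eta> * \<mu>"
    and F_bound: "F \<le> \<eta> * real (card A) / (2 * real L)"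
    and T_bound: "F + 2 * real L * F / \<eta> \<le> T"
begin

definition Q :: "nat set" where
  "Q = {p. prime p \<and> y < p \<and> (\<exists>n\<in>A. p dvd n)}"

text \<open>
The comments below call an integer good if its deficit is at most \<open>\<mu>\<close>, and bad otherwise.
\<close>

definition deficit :: "int \<Rightarrow> real" where
  "deficit x = (\<Sum>r\<in>{r \<in> primes_in L y1. \<not> int r dvd x}. 1 / real r)"

lemma finite_A: "finite A"
  using A_range by (rule finite_subset) simp

lemma finite_C: "finite C"
  using C_subset finite_A by (rule finite_subset)

lemma A_pos: "n \<in> A \<Longrightarrow> 0 < n" "n \<in> A \<Longrightarrow> n \<le> N"
  using A_range by auto

lemma Q_subset: "Q \<subseteq> primes_in y N"
  unfolding Q_def primes_in_def using A_pos by (auto dest: dvd_imp_le intro: order_trans)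

lemma finite_Q: "finite Q"
  using Q_subset by (rule finite_subset) simp

lemma rough_part_eq_prod:
  assumes n: "n \<in> A"
  shows "rough_part y n = \<Prod>{p \<in> prime_factors n. y < p}"
  unfolding rough_part_def
proof (rule prod.cong)
  fix p assume p: "p \<in> {p \<in> prime_factors n. y < p}"
  then have "\<not> p\<^sup>2 dvd n" using rough_squarefree[OF n] by auto
  then have "multiplicity p n < 2"
    using multiplicity_dvd'[of 2 p n] by (meson not_le)
  moreover have "multiplicity p n > 0"
    using p by (simp add: prime_factors_multiplicity)
  ultimately have "multiplicity p n = 1" by linarith
  then show "p ^ multiplicity p n = p" by simp
qed simp

lemma dvd_rough: "n \<in> A \<Longrightarrow> rough_part y n dvd n"
  using smooth_mult_rough[of n y] A_pos by (metis dvd_triv_right)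

lemma dvd_smooth: "n \<in> A \<Longrightarrow> smooth_part y n dvd n"
  using smooth_mult_rough[of n y] A_pos by (metis dvd_triv_left)

text \<open>
Fix a rough part \<open>g\<close>. The elements with this rough part that are not missed all divide the unique
multiple \<open>x\<close> of \<open>g\<close> in the window, so if \<open>x\<close> is bad, their smooth parts are integers up to \<open>N / g\<close> without
prime factors in a set of reciprocal sum above \<open>\<mu>\<close>. Turan's sieve bounds their number by \<open>3 N / (g \<mu>)\<close>.
The rough parts divisible by \<open>q\<close> are \<open>q\<close> times products of distinct primes above \<open>y\<close>, so that the sum of
\<open>1 / g\<close> is at most an Euler product divided by \<open>q\<close>.
\<close>

lemma card_bad_multiples_le:
  assumes q: "prime q" "y < q"
  shows "real (card {n \<in> C. q dvd n \<and> (\<exists>x. int n dvd x \<and> \<bar>x - h\<bar> \<le> int K \<and> \<mu> < deficit x)})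
     \<le> \<eta> * real N / (2 * real q)"
proof -
  define B where "B = {n \<in> C. q dvd n \<and> (\<exists>x. int n dvd x \<and> \<bar>x - h\<bar> \<le> int K \<and> \<mu> < deficit x)}"
  define G where "G = rough_part y ` B"
  have BA: "B \<subseteq> A" using C_subset by (auto simp: B_def)
  have finB: "finite B" using BA finite_A by (rule finite_subset)
  have fiber: "real (card {n \<in> B. rough_part y n = g}) \<le> 3 * real N / \<mu> * (1 / real g)" if "g \<in> G" for g
  proof -
    from that obtain n0 where n0: "n0 \<in> B" "rough_part y n0 = g" by (auto simp: G_def)
    then have n0A: "n0 \<in> A" using BA by auto
    from n0 obtain x where x: "int n0 dvd x" "\<bar>x - h\<bar> \<le> int K" "\<mu> < deficit x" by (auto simp: B_def)
    have g: "2 * K < g" using rough_gt[OF n0A] n0 by simp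
    have gx: "int g dvd x" using dvd_rough[OF n0A] n0 x(1) by (metis dvd_trans int_dvd_int_iff)
    define X where "X = N div g"
    \<comment> \<open>The sieving primes that \<open>x\<close> lacks; no divisor of \<open>x\<close> is divisible by any of them.\<close>
    define R where "R = {r \<in> primes_in L y1. \<not> int r dvd x}"
    have sub: "smooth_part y ` {n \<in> B. rough_part y n = g} \<subseteq> {a \<in> {1..X}. \<forall>r\<in>R. \<not> r dvd a}"
    proof (rule image_subsetI)
      fix n assume "n \<in> {n \<in> B. rough_part y n = g}"
      then have n: "n \<in> B" "rough_part y n = g" "n \<in> A" using BA by auto
      from n obtain x' where x': "int n dvd x'" "\<bar>x' - h\<bar> \<le> int K" by (auto simp: B_def)
      have "int g dvd x'" using dvd_rough[OF n(3)] n(2) x'(1) by (metis dvd_trans int_dvd_int_iff)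
      then have "x' = x" using window_unique[OF g _ x'(2) gx x(2)] by simp
      then have sx: "int (smooth_part y n) dvd x"
        using dvd_smooth[OF n(3)] x'(1) by (metis dvd_trans int_dvd_int_iff)
      have "smooth_part y n * g \<le> N" using smooth_mult_rough[of n y] A_pos[OF n(3)] n(2) by simp
      then have "smooth_part y n \<le> X" using g by (simp add: X_def less_eq_div_iff_mult_less_eq)
      moreover have "smooth_part y n \<ge> 1" using smooth_part_pos A_pos[OF n(3)] by (simp add: Suc_le_eq)
      moreover have "\<not> r dvd smooth_part y n" if "r \<in> R" for r
        using that sx unfolding R_def by (metis (mono_tags, lifting) dvd_trans int_dvd_int_iff mem_Collect_eq)
      ultimately show "smooth_part y n \<in> {a \<in> {1..X}. \<forall>r\<in>R. \<not> r dvd a}" by auto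
    qed
    have inj: "inj_on (smooth_part y) {n \<in> B. rough_part y n = g}"
    proof (rule inj_onI)
      fix m n assume "m \<in> {n \<in> B. rough_part y n = g}" "n \<in> {n \<in> B. rough_part y n = g}"
        "smooth_part y m = smooth_part y n"
      then show "m = n" using smooth_mult_rough[of m y] smooth_mult_rough[of n y] A_pos BA
        by (metis (mono_tags, lifting) mem_Collect_eq subsetD)
    qed
    have "real (card {n \<in> B. rough_part y n = g}) \<le> real (card {a \<in> {1..X}. \<forall>r\<in>R. \<not> r dvd a})"
      using card_inj_on_le[OF inj sub] by simp
    also have "\<dots> \<le> 3 * real X / deficit x"
    proof (rule Turan_sieve)
      show "finite R" by (simp add: R_def)
      have "card R \<le> card {1..y1}"
        by (rule card_mono) (auto simp: R_def primes_in_def)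
      also have "\<dots> \<le> smooth_part y n0" using smooth_ge[OF n0A] by simp
      also have "\<dots> \<le> X" using sub n0 by auto
      finally show "card R \<le> X" .
      show "0 < deficit x" using x mu_pos by linarith
    qed (auto simp: R_def deficit_def primes_in_def)
    also have "\<dots> \<le> 3 * real X / \<mu>"
      using x mu_pos by (intro divide_left_mono) auto
    also have "\<dots> \<le> 3 * (real N / real g) / \<mu>"
      using mu_pos by (intro divide_right_mono mult_left_mono) (auto simp: X_def of_nat_div_le_of_nat)
    finally show ?thesis by (simp add: field_simps)
  qed
  \<comment> \<open>As \<open>q\<close> itself is one of the distinct primes of the rough part, it can be split off.\<close>
  have G_sub: "G \<subseteq> (\<lambda>U. q * \<Prod>U) ` Pow (primes_in y N)"
  proof
    fix g assume "g \<in> G"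
    then obtain n where n: "n \<in> B" "g = rough_part y n" by (auto simp: G_def)
    then have nA: "n \<in> A" using BA by auto
    let ?P = "{p \<in> prime_factors n. y < p}"
    have "q \<in> ?P" using q n A_pos[OF nA] by (auto simp: B_def prime_factors_dvd)
    then have "g = q * \<Prod>(?P - {q})"
      using n rough_part_eq_prod[OF nA] by (simp add: prod.remove)
    moreover have "?P - {q} \<in> Pow (primes_in y N)"
      using A_pos[OF nA] by (auto simp: primes_in_def prime_factors_dvd dest!: dvd_imp_le)
    ultimately show "g \<in> (\<lambda>U. q * \<Prod>U) ` Pow (primes_in y N)" by blast
  qed
  have "card B = (\<Sum>g\<in>G. card {n \<in> B. rough_part y n = g})"
  proof -
    have "card B = (\<Sum>n\<in>B. 1)" by simp
    also have "\<dots> = (\<Sum>g\<in>G. \<Sum>n\<in>{n \<in> B. rough_part y n = g}. 1)"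
      unfolding G_def using finB by (rule sum.image_gen)
    finally show ?thesis by simp
  qed
  then have "real (card B) = (\<Sum>g\<in>G. real (card {n \<in> B. rough_part y n = g}))" by simp
  also have "\<dots> \<le> (\<Sum>g\<in>G. 3 * real N / \<mu> * (1 / real g))"
    by (rule sum_mono[OF fiber])
  also have "\<dots> = 3 * real N / \<mu> * (\<Sum>g\<in>G. 1 / real g)"
    by (simp only: sum_distrib_left)
  also have "\<dots> \<le> 3 * real N / \<mu> * (1 / real q * (\<Prod>p\<in>primes_in y N. 1 + 1 / real p))"
  proof (rule mult_left_mono)
    have "(\<Sum>g\<in>G. 1 / real g) \<le> (\<Sum>g\<in>(\<lambda>U. q * \<Prod>U) ` Pow (primes_in y N). 1 / real g)"
      by (rule sum_mono2) (use G_sub in auto)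
    also have "\<dots> \<le> sum ((\<lambda>g. 1 / real g) \<circ> (\<lambda>U. q * \<Prod>U)) (Pow (primes_in y N))"
      by (rule sum_image_le) (auto intro!: mult_nonneg_nonneg prod_nonneg)
    also have "\<dots> = (\<Sum>U\<in>Pow (primes_in y N). 1 / real q * ((\<Prod>p\<in>U. 1 / real p) * (\<Prod>p\<in>primes_in y N - U. 1)))"
      by (intro sum.cong refl) (simp add: prod_dividef)
    also have "\<dots> = 1 / real q * (\<Sum>U\<in>Pow (primes_in y N). (\<Prod>p\<in>U. 1 / real p) * (\<Prod>p\<in>primes_in y N - U. 1))"
      by (rule sum_distrib_left[symmetric])
    also have "(\<Sum>U\<in>Pow (primes_in y N). (\<Prod>p\<in>U. 1 / real p) * (\<Prod>p\<in>primes_in y N - U. 1)) =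
        (\<Prod>p\<in>primes_in y N. 1 / real p + 1)"
      using prod_add[of "primes_in y N" "\<lambda>p. 1 / real p" "\<lambda>_. 1"] by simp
    finally show "(\<Sum>g\<in>G. 1 / real g) \<le> 1 / real q * (\<Prod>p\<in>primes_in y N. 1 + 1 / real p)"
      by (simp add: add.commute)
  qed (use mu_pos in auto)
  also have "\<dots> = 6 * (\<Prod>p\<in>primes_in y N. 1 + 1 / real p) / \<mu> * (real N / (2 * real q))"
    by simp
  also have "\<dots> \<le> \<eta> * (real N / (2 * real q))"
    using eta_mu mu_pos by (intro mult_right_mono) (auto simp: field_simps)
  finally show ?thesis by (simp add: B_def)
qed

text \<open>
If no good integer in the window is divisible by \<open>q\<close>, the multiples of \<open>q\<close> in \<open>C\<close> that are not missed all
divide bad integers; these are at most half of the multiples of \<open>q\<close> in \<open>C\<close>.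
\<close>

lemma many_misses:
  assumes q: "q \<in> Q" and none: "\<And>x. \<bar>x - h\<bar> \<le> int K \<Longrightarrow> int q dvd x \<Longrightarrow> \<mu> < deficit x"
  shows "\<eta> * real N / (2 * real q) \<le> real (card {n \<in> misses K C h. q dvd n})"
proof -
  let ?B = "{n \<in> C. q dvd n \<and> (\<exists>x. int n dvd x \<and> \<bar>x - h\<bar> \<le> int K \<and> \<mu> < deficit x)}"
  let ?M = "{n \<in> misses K C h. q dvd n}"
  have "{n \<in> C. q dvd n} \<subseteq> ?M \<union> ?B"
  proof
    fix n assume n: "n \<in> {n \<in> C. q dvd n}"
    show "n \<in> ?M \<union> ?B"
    proof (cases "n \<in> misses K C h")
      case False
      then obtain x where x: "int n dvd x" "\<bar>x - h\<bar> \<le> int K"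
        using n by (auto simp: misses_def not_less)
      moreover have "int q dvd x" using n x(1) by (metis (mono_tags, lifting) dvd_trans int_dvd_int_iff mem_Collect_eq)
      ultimately show ?thesis using none n by blast
    qed (use n in auto)
  qed
  then have "card {n \<in> C. q dvd n} \<le> card (?M \<union> ?B)"
    by (rule card_mono[rotated]) (auto simp: misses_def finite_C)
  also have "\<dots> \<le> card ?M + card ?B" by (rule card_Un_le)
  finally have "real (card {n \<in> C. q dvd n}) \<le> real (card ?M) + real (card ?B)" by linarith
  moreover have "real (card ?B) \<le> \<eta> * real N / (2 * real q)"
    using q by (intro card_bad_multiples_le) (auto simp: Q_def)
  moreover have "\<eta> * real N / real q \<le> real (card {n \<in> C. q dvd n})"
    using q rich_prime by (auto simp: Q_def)
  moreover have "\<eta> * real N / real q = 2 * (\<eta> * real N / (2 * real q))" by simp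
  ultimately show ?thesis by linarith
qed

lemma card_primes_dvd_le:
  assumes P: "finite P" "\<And>p. p \<in> P \<Longrightarrow> prime p" "\<And>p. p \<in> P \<Longrightarrow> int p dvd x" and x: "x \<noteq> 0" "\<bar>x\<bar> \<le> int N"
  shows "card P \<le> L"
proof -
  have "\<Prod>P dvd nat \<bar>x\<bar>"
    using P by (intro prod_primes_dvd) (auto simp: dvd_nat_abs_iff)
  then have "\<Prod>P \<le> nat \<bar>x\<bar>" using x by (intro dvd_imp_le) auto
  also have "\<dots> \<le> N" using x by linarith
  finally have "\<Prod>P < 2 ^ L" using N_bound by linarith
  moreover have "(\<Prod>p\<in>P. 2) \<le> \<Prod>P"
    using P prime_ge_2_nat by (intro prod_mono) auto
  ultimately have "2 ^ card P < (2::nat) ^ L" by (simp only: prod_constant)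
  then show ?thesis by (simp add: power_strict_increasing_iff)
qed

text \<open>
Two good integers in the window share sieving primes of reciprocal sum more than 1. These divide the
difference, which has too few prime factors for that unless it is 0.
\<close>

lemma good_unique:
  assumes x: "\<bar>x - h\<bar> \<le> int K" "deficit x \<le> \<mu>" and x': "\<bar>x' - h\<bar> \<le> int K" "deficit x' \<le> \<mu>"
  shows "x = x'"
proof (rule ccontr)
  assume neq: "x \<noteq> x'"
  let ?R = "primes_in L y1"
  let ?D = "\<lambda>x. {r \<in> ?R. \<not> int r dvd x}"
  let ?J = "{r \<in> ?R. int r dvd x \<and> int r dvd x'}"
  have "card ?J \<le> L"
  proof (rule card_primes_dvd_le[where x = "x - x'"])
    show "\<bar>x - x'\<bar> \<le> int N" using x x' K_bound by linarith
  qed (use neq in \<open>auto simp: primes_in_def\<close>)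
  have "(\<Sum>r\<in>?J. 1 / real r) \<le> (\<Sum>r\<in>?J. 1 / real L)"
    using L_pos by (intro sum_mono divide_left_mono) (auto simp: primes_in_def)
  also have "\<dots> = real (card ?J) / real L" by simp
  also have "\<dots> \<le> 1" using \<open>card ?J \<le> L\<close> L_pos by simp
  finally have J: "(\<Sum>r\<in>?J. 1 / real r) \<le> 1" .
  have "?R = ?J \<union> (?D x \<union> ?D x')" by auto
  then have "(\<Sum>r\<in>?R. 1 / real r) \<le> (\<Sum>r\<in>?J. 1 / real r) + (\<Sum>r\<in>?D x \<union> ?D x'. 1 / real r)"
    using sum_Un_le[of ?J "?D x \<union> ?D x'" "\<lambda>r. 1 / real r"] by simp
  also have "\<dots> \<le> (\<Sum>r\<in>?J. 1 / real r) + (deficit x + deficit x')"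
    unfolding deficit_def by (intro add_left_mono sum_Un_le) auto
  finally show False using J x x' mu_bound by linarith
qed

lemma sum_misses_le:
  assumes U: "U \<subseteq> Q"
  shows "(\<Sum>q\<in>U. real (card {n \<in> misses K C h. q dvd n})) \<le> real L * real (card (misses K C h))"
proof -
  let ?M = "misses K C h"
  have M: "?M \<subseteq> A" using C_subset by (auto simp: misses_def)
  then have finM: "finite ?M" using finite_A by (rule finite_subset)
  have finU: "finite U" using U finite_Q by (rule finite_subset)
  have "(\<Sum>q\<in>U. real (card {n \<in> ?M. q dvd n})) = (\<Sum>q\<in>U. \<Sum>n\<in>?M. of_bool (q dvd n))"
    using finM by (intro sum.cong refl) (simp add: of_bool_def sum.If_cases Int_def)
  also have "\<dots> = (\<Sum>n\<in>?M. \<Sum>q\<in>U. of_bool (q dvd n))" by (rule sum.swap)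
  also have "\<dots> = (\<Sum>n\<in>?M. real (card {q \<in> U. q dvd n}))"
    using finU by (intro sum.cong refl) (simp add: of_bool_def sum.If_cases Int_def)
  also have "\<dots> \<le> (\<Sum>n\<in>?M. real L)"
  proof (intro sum_mono)
    fix n assume "n \<in> ?M"
    then have n: "0 < n" "n \<le> N" using M A_pos by auto
    have "card {q \<in> U. q dvd n} \<le> L"
      by (rule card_primes_dvd_le[where x = "int n"]) (use finU U n in \<open>auto simp: Q_def\<close>)
    then show "real (card {q \<in> U. q dvd n}) \<le> real L" by simp
  qed
  finally show ?thesis by (simp add: mult.commute)
qed

lemma sum_Q_ge: "real (card A) \<le> (\<Sum>q\<in>Q. real N / real q)"
proof -
  have "A \<subseteq> (\<Union>q\<in>Q. {n \<in> {1..N}. q dvd n})"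
  proof
    fix n assume n: "n \<in> A"
    have "rough_part y n \<noteq> 1" using rough_gt[OF n] K_pos by linarith
    then have "{p \<in> prime_factors n. y < p} \<noteq> {}"
      using rough_part_eq_prod[OF n] by (metis prod.empty)
    then obtain p where "p \<in> prime_factors n" "y < p" by auto
    then show "n \<in> (\<Union>q\<in>Q. {n \<in> {1..N}. q dvd n})"
      using n A_range by (auto simp: Q_def prime_factors_dvd)
  qed
  then have "card A \<le> card (\<Union>q\<in>Q. {n \<in> {1..N}. q dvd n})"
    by (rule card_mono[rotated]) (use finite_Q in auto)
  also have "\<dots> \<le> (\<Sum>q\<in>Q. card {n \<in> {1..N}. q dvd n})"
    by (rule card_UN_le[OF finite_Q])
  finally have "real (card A) \<le> (\<Sum>q\<in>Q. real (card {n \<in> {1..N}. q dvd n}))"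
    by (metis of_nat_le_iff of_nat_sum)
  also have "\<dots> \<le> (\<Sum>q\<in>Q. real N / real q)"
    by (intro sum_mono card_multiples_le) (auto simp: Q_def prime_gt_0_nat)
  finally show ?thesis .
qed

text \<open>
Without a good integer, a fixed proportion of the multiples of every large prime is missed. Together
these are at least \<open>F\<close> elements, since every element of \<open>A\<close> is a multiple of a large prime.
\<close>

lemma exists_good:
  assumes few: "real (card (misses K C h)) < F"
  shows "\<exists>x. \<bar>x - h\<bar> \<le> int K \<and> deficit x \<le> \<mu>"
proof (rule ccontr)
  assume "\<not> ?thesis"
  then have none: "\<mu> < deficit x" if "\<bar>x - h\<bar> \<le> int K" for x
    using that by (meson not_le)
  have "\<eta> / 2 * real (card A) \<le> \<eta> / 2 * (\<Sum>q\<in>Q. real N / real q)"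
    using sum_Q_ge eta_pos by (intro mult_left_mono) auto
  also have "\<dots> = (\<Sum>q\<in>Q. \<eta> * real N / (2 * real q))"
    by (simp add: sum_distrib_left)
  also have "\<dots> \<le> (\<Sum>q\<in>Q. real (card {n \<in> misses K C h. q dvd n}))"
    using none by (intro sum_mono many_misses) auto
  also have "\<dots> \<le> real L * real (card (misses K C h))"
    by (rule sum_misses_le) simp
  finally have "\<eta> * real (card A) / (2 * real L) \<le> real (card (misses K C h))"
    using L_pos by (simp add: field_simps)
  then show False using few F_bound by linarith
qed

text \<open>
When fewer than \<open>F\<close> elements are missed, let \<open>x\<close> be the good integer of the window and \<open>U\<close> the set of
large primes of the family that do not divide it. No good integer is divisible by a prime of \<open>U\<close>, so each of them entails many misses. As the misses are
few, the sum of \<open>1 / q\<close> over \<open>U\<close> is small. Hence for each smooth part \<open>s\<close> that occurs there is an element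
\<open>m \<in> C\<close> with smooth part \<open>s\<close> that is not missed and has no prime factor in \<open>U\<close>. Its rough part divides
both \<open>x\<close> and the multiple of \<open>m\<close> in the window; being larger than \<open>2K\<close>, it forces the two to be equal, so \<open>s\<close>
divides \<open>x\<close>. Thus \<open>x\<close> is divisible by everything except possibly the primes in \<open>U\<close>.
\<close>

lemma misses_dichotomy:
  "F \<le> real (card (misses K C h)) \<or>
   (\<exists>x U. \<bar>x - h\<bar> \<le> int K \<and> U \<subseteq> Q \<and> int (Lcm A) dvd x * int (\<Prod>U) \<and>
      \<eta> * real N / (2 * real Z * real L) * real (card U) \<le> real (card (misses K C h)))"
proof (cases "F \<le> real (card (misses K C h))")
  case False
  let ?f = "real (card (misses K C h))"
  from False obtain x where x: "\<bar>x - h\<bar> \<le> int K" "deficit x \<le> \<mu>"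
    using exists_good[of h] by auto
  define U where "U = {q \<in> Q. \<not> int q dvd x}"
  have UQ: "U \<subseteq> Q" by (auto simp: U_def)
  have finU: "finite U" using UQ finite_Q by (rule finite_subset)
  have miss_U: "(\<Sum>q\<in>U. \<eta> * real N / (2 * real q)) \<le> real L * ?f"
  proof -
    have "(\<Sum>q\<in>U. \<eta> * real N / (2 * real q)) \<le> (\<Sum>q\<in>U. real (card {n \<in> misses K C h. q dvd n}))"
    proof (intro sum_mono many_misses)
      fix q x' assume "q \<in> U" "\<bar>x' - h\<bar> \<le> int K" "int q dvd x'"
      then show "\<mu> < deficit x'" using good_unique[OF x, of x'] by (auto simp: U_def not_le[symmetric])
    qed (use UQ in auto)
    then show ?thesis using sum_misses_le[OF UQ, of h] by linarith
  qed
  \<comment> \<open>The elements with the given smooth part outnumber the missed ones and the multiples of primes in \<open>U\<close>.\<close>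
  have smooth_dvd: "int (smooth_part y n) dvd x" if n: "n \<in> A" for n
  proof -
    let ?S = "{m \<in> C. smooth_part y m = smooth_part y n}"
    let ?D = "\<Union>q\<in>U. {m \<in> {1..N}. q dvd m}"
    have "\<not> ?S \<subseteq> misses K C h \<union> ?D"
    proof
      assume "?S \<subseteq> misses K C h \<union> ?D"
      then have "card ?S \<le> card (misses K C h \<union> ?D)"
        by (rule card_mono[rotated]) (auto simp: misses_def finite_C finU)
      also have "\<dots> \<le> card (misses K C h) + card ?D" by (rule card_Un_le)
      also have "card ?D \<le> (\<Sum>q\<in>U. card {m \<in> {1..N}. q dvd m})"
        by (rule card_UN_le[OF finU])
      finally have "real (card ?S) \<le> real (card (misses K C h) + (\<Sum>q\<in>U. card {m \<in> {1..N}. q dvd m}))"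
        unfolding of_nat_le_iff by simp
      also have "\<dots> = ?f + (\<Sum>q\<in>U. real (card {m \<in> {1..N}. q dvd m}))" by simp
      also have "\<dots> \<le> ?f + (\<Sum>q\<in>U. real N / real q)"
        using UQ by (intro add_left_mono sum_mono card_multiples_le) (auto simp: Q_def prime_gt_0_nat)
      also have "(\<Sum>q\<in>U. real N / real q) = 2 / \<eta> * (\<Sum>q\<in>U. \<eta> * real N / (2 * real q))"
        unfolding sum_distrib_left using eta_pos by (intro sum.cong) auto
      also have "\<dots> \<le> 2 / \<eta> * (real L * ?f)"
        using miss_U eta_pos by (intro mult_left_mono) auto
      also have "\<dots> < 2 / \<eta> * (real L * F)"
        using False eta_pos L_pos by (intro mult_strict_left_mono) auto
      finally have "real (card ?S) < F + 2 * real L * F / \<eta>"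
        using False by simp
      then show False using rich_smooth[OF n] T_bound by linarith
    qed
    then obtain m where m: "m \<in> C" "smooth_part y m = smooth_part y n" "m \<notin> misses K C h" "m \<notin> ?D" by blast
    have mA: "m \<in> A" using m C_subset by auto
    from m obtain x' where x': "int m dvd x'" "\<bar>x' - h\<bar> \<le> int K" by (auto simp: misses_def not_less)
    have "int p dvd x" if "p \<in> prime_factors m" "y < p" for p
    proof -
      have "p \<in> Q" using that mA by (auto simp: Q_def prime_factors_dvd)
      moreover have "p \<notin> U" using m(4) that mA A_range by (auto simp: prime_factors_dvd)
      ultimately show ?thesis by (auto simp: U_def)
    qed
    then have "\<Prod>{p \<in> prime_factors m. y < p} dvd nat \<bar>x\<bar>"
      by (intro prod_primes_dvd) (auto simp: dvd_nat_abs_iff)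
    then have "int (rough_part y m) dvd x"
      unfolding rough_part_eq_prod[OF mA] by (simp only: dvd_nat_abs_iff)
    moreover have "int (rough_part y m) dvd x'"
      using dvd_rough[OF mA] x'(1) by (metis dvd_trans int_dvd_int_iff)
    ultimately have "x = x'" using window_unique[OF rough_gt[OF mA] _ x(1) _ x'(2)] by simp
    then show ?thesis
      using dvd_smooth[OF mA] x'(1) m(2) by (metis dvd_trans int_dvd_int_iff)
  qed
  have "Lcm A dvd nat \<bar>x * int (\<Prod>U)\<bar>"
  proof (rule Lcm_least)
    fix n assume n: "n \<in> A"
    have "smooth_part y n dvd nat \<bar>x * int (\<Prod>U)\<bar>"
      using dvd_mult2[OF smooth_dvd[OF n], of "int (\<Prod>U)"] by (simp only: dvd_nat_abs_iff)
    moreover have "rough_part y n dvd nat \<bar>x * int (\<Prod>U)\<bar>"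
      unfolding rough_part_eq_prod[OF n]
    proof (rule prod_primes_dvd)
      fix p assume p: "p \<in> {p \<in> prime_factors n. y < p}"
      then have pQ: "p \<in> Q" using n by (auto simp: Q_def prime_factors_dvd)
      have "int p dvd x * int (\<Prod>U)"
      proof (cases "p \<in> U")
        case True
        then have "p dvd \<Prod>U" using dvd_prodI[OF finU, of p "\<lambda>p. p"] by simp
        then show ?thesis by (metis dvd_mult int_dvd_int_iff)
      next
        case False
        then show ?thesis using pQ by (simp add: U_def)
      qed
      then show "p dvd nat \<bar>x * int (\<Prod>U)\<bar>"
        by (simp only: dvd_nat_abs_iff)
    qed auto
    ultimately have "smooth_part y n * rough_part y n dvd nat \<bar>x * int (\<Prod>U)\<bar>"
      using coprime_smooth_rough by (rule divides_mult)
    then show "n dvd nat \<bar>x * int (\<Prod>U)\<bar>"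
      using smooth_mult_rough A_pos[OF n] by simp
  qed
  then have "int (Lcm A) dvd x * int (\<Prod>U)"
    by (simp only: dvd_nat_abs_iff)
  moreover have "\<eta> * real N / (2 * real Z * real L) * real (card U) \<le> ?f"
  proof -
    have "real (card U) * (\<eta> * real N / (2 * real Z)) = (\<Sum>q\<in>U. \<eta> * real N / (2 * real Z))" by simp
    also have "\<dots> \<le> (\<Sum>q\<in>U. \<eta> * real N / (2 * real q))"
      using UQ eta_pos prime_le
      by (intro sum_mono divide_left_mono) (auto simp: Q_def prime_gt_0_nat Z_pos)
    also have "\<dots> \<le> real L * ?f" by (rule miss_U)
    finally show ?thesis using L_pos Z_pos by (simp add: field_simps)
  qed
  ultimately show ?thesis using x UQ by blast
qed simp

end

section \<open>Pruning, representatives and unit sums\<close>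

text \<open>
Discard a class that has become smaller than its threshold, and repeat. A discarded class stays
empty, so each class is paid for at most once.
\<close>

lemma prune_classes:
  fixes cls :: "'i \<Rightarrow> 'a set" and t :: "'i \<Rightarrow> real"
  assumes "finite J" "finite A" "\<And>i. i \<in> J \<Longrightarrow> 0 \<le> t i"
  shows "\<exists>A'\<subseteq>A. real (card (A - A')) \<le> (\<Sum>i\<in>J. t i) \<and>
     (\<forall>i\<in>J. A' \<inter> cls i = {} \<or> t i \<le> real (card (A' \<inter> cls i)))"
  using assms
proof (induction "card J" arbitrary: J A rule: less_induct)
  case less
  show ?case
  proof (cases "\<forall>i\<in>J. t i \<le> real (card (A \<inter> cls i))")
    case True
    then show ?thesis using less.prems by (intro exI[of _ A]) (auto simp: sum_nonneg)
  next
    case False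
    then obtain i where i: "i \<in> J" "real (card (A \<inter> cls i)) < t i" by (auto simp: not_le)
    have "card (J - {i}) < card J" using i less.prems by (intro psubset_card_mono) auto
    from less.hyps[OF this, of "A - cls i"] less.prems obtain A' where A': "A' \<subseteq> A - cls i"
      "real (card (A - cls i - A')) \<le> (\<Sum>j\<in>J - {i}. t j)"
      "\<forall>j\<in>J - {i}. A' \<inter> cls j = {} \<or> t j \<le> real (card (A' \<inter> cls j))" by auto
    have "A - A' = (A \<inter> cls i) \<union> (A - cls i - A')" using A' by auto
    then have "card (A - A') \<le> card (A \<inter> cls i) + card (A - cls i - A')"
      by (metis card_Un_le)
    then have "real (card (A - A')) \<le> t i + (\<Sum>j\<in>J - {i}. t j)"
      using i A' by linarith
    also have "\<dots> = (\<Sum>j\<in>J. t j)"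
      using i less.prems by (simp add: sum.remove)
    finally show ?thesis using A' by (intro exI[of _ A']) auto
  qed
qed

lemma select_representatives:
  fixes cls :: "'i \<Rightarrow> 'a set" and t :: "'i \<Rightarrow> real"
  assumes "finite J" "finite A" "\<And>i. i \<in> J \<Longrightarrow> 0 \<le> t i"
    and rich: "\<And>i. i \<in> J \<Longrightarrow> A \<inter> cls i = {} \<or> t i \<le> real (card (A \<inter> cls i))"
  shows "\<exists>C\<subseteq>A. real (card C) \<le> (\<Sum>i\<in>J. t i + 1) \<and>
     (\<forall>i\<in>J. A \<inter> cls i = {} \<or> t i \<le> real (card (C \<inter> cls i)))"
proof -
  have "\<exists>S. S \<subseteq> A \<inter> cls i \<and> real (card S) \<le> t i + 1 \<and> (A \<inter> cls i = {} \<or> t i \<le> real (card S))" if i: "i \<in> J" for i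
  proof (cases "A \<inter> cls i = {}")
    case True
    then show ?thesis using assms(3)[OF i] by (intro exI[of _ "{}"]) auto
  next
    case False
    then have "nat \<lceil>t i\<rceil> \<le> card (A \<inter> cls i)" using rich[OF i] by linarith
    then obtain S where S: "S \<subseteq> A \<inter> cls i" "card S = nat \<lceil>t i\<rceil>"
      by (meson obtain_subset_with_card_n)
    have "real (card S) = of_int \<lceil>t i\<rceil>" using S assms(3)[OF i] by simp
    then have "real (card S) \<le> t i + 1" "t i \<le> real (card S)" by linarith+
    then show ?thesis using S by blast
  qed
  then obtain S where S: "\<And>i. i \<in> J \<Longrightarrow> S i \<subseteq> A \<inter> cls i" "\<And>i. i \<in> J \<Longrightarrow> real (card (S i)) \<le> t i + 1"
    "\<And>i. i \<in> J \<Longrightarrow> A \<inter> cls i = {} \<or> t i \<le> real (card (S i))"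
    by metis
  define C where "C = (\<Union>i\<in>J. S i)"
  have CA: "C \<subseteq> A" using S(1) by (auto simp: C_def)
  then have finC: "finite C" using assms(2) by (rule finite_subset)
  have "card C \<le> (\<Sum>i\<in>J. card (S i))" unfolding C_def by (rule card_UN_le[OF assms(1)])
  then have "real (card C) \<le> (\<Sum>i\<in>J. real (card (S i)))" by (metis of_nat_le_iff of_nat_sum)
  also have "\<dots> \<le> (\<Sum>i\<in>J. t i + 1)" by (intro sum_mono S(2))
  finally have "real (card C) \<le> (\<Sum>i\<in>J. t i + 1)" .
  moreover have "A \<inter> cls i = {} \<or> t i \<le> real (card (C \<inter> cls i))" if i: "i \<in> J" for i
  proof -
    have "card (S i) \<le> card (C \<inter> cls i)"
      using S(1)[OF i] i finC by (intro card_mono) (auto simp: C_def)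
    then show ?thesis using S(3)[OF i] by linarith
  qed
  ultimately show ?thesis using CA by blast
qed

text \<open>
Drop elements one at a time until the sum would fall below \<open>\<tau>\<close>; the overshoot is less than one term.
\<close>

lemma greedy_subsum:
  fixes f :: "'a \<Rightarrow> real"
  assumes "finite X" "\<And>x. x \<in> X \<Longrightarrow> f x < d" "0 < d" "0 \<le> \<tau>" "\<tau> \<le> sum f X"
  shows "\<exists>B\<subseteq>X. \<tau> \<le> sum f B \<and> sum f B < \<tau> + d"
  using assms
proof (induction X rule: finite_induct)
  case (insert x X)
  show ?case
  proof (cases "\<tau> \<le> sum f X")
    case True
    then show ?thesis using insert by (metis insert_iff subset_insertI2)
  next
    case False
    then have "sum f (insert x X) < \<tau> + d" using insert.hyps insert.prems(1)[of x] by simp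
    then show ?thesis using insert.prems by blast
  qed
qed auto

text \<open>
The bound is the integral of \<open>1 / x\<close> over the part of \<open>[1, N + 1]\<close> above \<open>N - |X| + 1\<close>, which is the extremal
case of \<open>X\<close> being the top of the interval.
\<close>

lemma recip_sum_ge:
  assumes "X \<subseteq> {1..N}"
  shows "ln ((real N + 1) / (real N - real (card X) + 1)) \<le> recip_sum X"
  using assms
proof (induction N arbitrary: X)
  case (Suc N)
  have finX: "finite X" using Suc.prems by (rule finite_subset) simp
  have step: "ln ((real N + 2) / (real N + 1)) \<le> 1 / (real N + 1)"
    using ln_add_one_self_le_self[of "1 / (real N + 1)"] by (simp add: add_divide_eq_iff add.commute)
  show ?case
  proof (cases "Suc N \<in> X")
    case True
    let ?Y = "X - {Suc N}"
    have Y: "?Y \<subseteq> {1..N}" using Suc.prems by auto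
    have cY: "card X = card ?Y + 1" using card.remove[OF finX True] by simp
    have "card ?Y \<le> N" using card_mono[OF _ Y] by simp
    then have pos: "real N - real (card ?Y) + 1 > 0" by linarith
    have "ln ((real (Suc N) + 1) / (real (Suc N) - real (card X) + 1)) =
      ln ((real N + 2) / (real N + 1)) + ln ((real N + 1) / (real N - real (card ?Y) + 1))"
    proof -
      have "(real (Suc N) + 1) / (real (Suc N) - real (card X) + 1) =
        (real N + 2) / (real N + 1) * ((real N + 1) / (real N - real (card ?Y) + 1))"
        using pos unfolding cY by (simp add: add.commute)
      then show ?thesis using pos by (simp only:) (rule ln_mult_pos, auto)
    qed
    also have "\<dots> \<le> 1 / (real N + 1) + recip_sum ?Y"
      using step Suc.IH[OF Y] by (rule add_mono)
    also have "\<dots> = recip_sum X"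
      unfolding recip_sum_def using True finX by (subst sum.remove[of X "Suc N"]) (auto simp: add.commute)
    finally show ?thesis .
  next
    case False
    then have Y: "X \<subseteq> {1..N}" using Suc.prems by (auto simp: le_Suc_eq)
    have c: "card X \<le> N" using card_mono[OF _ Y] by simp
    have "(real N + 2) / (real N + 1 - real (card X) + 1) \<le> (real N + 1) / (real N - real (card X) + 1)"
    proof -
      have "(real N + 2) * (real N - real (card X) + 1) \<le> (real N + 1) * (real N + 1 - real (card X) + 1)"
        by (simp add: algebra_simps)
      moreover have "real N - real (card X) + 1 > 0" using c by simp
      ultimately show ?thesis by (simp add: pos_divide_le_eq pos_le_divide_eq)
    qed
    then have "ln ((real (Suc N) + 1) / (real (Suc N) - real (card X) + 1)) \<le> ln ((real N + 1) / (real N - real (card X) + 1))"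
      using c by (subst ln_le_cancel_iff) (auto intro!: divide_pos_pos simp: add.commute)
    then show ?thesis using Suc.IH[OF Y] by linarith
  qed
qed (simp add: recip_sum_def)

context rich_family
begin

lemma Lcm_pos: "Lcm A > 0"
  using finite_A A_pos by (metis Lcm_0_iff_nat gr0I less_irrefl)

text \<open>
The smooth parts divide \<open>fact S\<close>, and the rough parts are products of distinct primes up to \<open>Z\<close>. The
bound beats \<open>N ln N\<close> by the factor \<open>N / Z\<close>.
\<close>

lemma Lcm_le:
  assumes S: "\<And>n. n \<in> A \<Longrightarrow> smooth_part y n \<le> S" and SZ: "S \<le> Z" and ZN: "Z \<le> N"
  shows "real (Lcm A) \<le> exp (2 * real Z * ln (real N))"
proof -
  have N0: "N > 0" using ZN Z_pos by simp
  let ?M = "fact S * \<Prod>(primes_in y Z)"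
  have "Lcm A dvd ?M"
  proof (rule Lcm_least)
    fix n assume n: "n \<in> A"
    have "smooth_part y n dvd fact S"
      using S[OF n] smooth_part_pos A_pos[OF n] by (intro dvd_fact) (auto simp: Suc_le_eq)
    moreover have "rough_part y n dvd \<Prod>(primes_in y Z)"
      unfolding rough_part_eq_prod[OF n] using prime_le[OF n]
      by (intro prod_dvd_prod_subset) (auto simp: primes_in_def prime_factors_dvd)
    ultimately show "n dvd ?M"
      using smooth_mult_rough[of n y] A_pos[OF n] by (metis mult_dvd_mono)
  qed
  moreover have M0: "?M > 0" by (auto intro!: prod_pos dest: primes_inD)
  ultimately have "Lcm A \<le> ?M" by (rule dvd_imp_le)
  also have "?M \<le> N ^ Z * N ^ Z"
  proof (rule mult_mono)
    have "fact S \<le> S ^ S" using fact_le_power[of S, where 'a = nat] by simp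
    also have "\<dots> \<le> N ^ S" using SZ ZN by (intro power_mono) auto
    also have "\<dots> \<le> N ^ Z" using SZ N0 by (intro power_increasing) auto
    finally show "fact S \<le> N ^ Z" .
    have "\<Prod>(primes_in y Z) \<le> (\<Prod>p\<in>primes_in y Z. N)"
      using ZN by (intro prod_mono) (auto simp: primes_in_def)
    also have "\<dots> = N ^ card (primes_in y Z)" by simp
    also have "\<dots> \<le> N ^ Z"
    proof (rule power_increasing)
      have "card (primes_in y Z) \<le> card {1..Z}"
        by (rule card_mono) (auto simp: primes_in_def prime_ge_1_nat)
      then show "card (primes_in y Z) \<le> Z" by simp
    qed (use N0 in simp)
    finally show "\<Prod>(primes_in y Z) \<le> N ^ Z" .
  qed auto
  finally have "real (Lcm A) \<le> real (N ^ Z * N ^ Z)" by (simp only: of_nat_le_iff)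
  also have "\<dots> = exp (real Z * ln (real N)) * exp (real Z * ln (real N))"
    using N0 by (simp add: exp_of_nat_mult)
  also have "\<dots> = exp (2 * real Z * ln (real N))"
    by (simp add: exp_add[symmetric])
  finally show ?thesis .
qed

lemma exists_recip_sum_eq_1:
  assumes S: "\<And>n. n \<in> A \<Longrightarrow> smooth_part y n \<le> S" and SZ: "S \<le> Z" and ZN: "Z \<le> N" and N5: "5 \<le> N"
    and B: "B \<subseteq> A - C" and near: "\<bar>recip_sum B + recip_sum C / 2 - 1\<bar> * real K \<le> 1 / 4"
    and B_pos: "0 < recip_sum B" and BC: "recip_sum B + recip_sum C < 2"
    and num1: "2 * real Z * ln (real N) + 1 \<le> (real K / real N)\<^sup>2 * F"
    and num2: "5 * ln (real N) \<le> (real K / real N)\<^sup>2 * (\<eta> * real N / (2 * real Z * real L))"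
  shows "\<exists>A'\<subseteq>A. recip_sum A' = 1"
proof -
  let ?P = "Lcm A"
  define k where "k = (real K / real N)\<^sup>2"
  define t where "t = \<eta> * real N / (2 * real Z * real L)"
  have nP: "n dvd ?P" if "n \<in> A" for n using that by (rule dvd_Lcm)
  have "(\<Sum>h\<in>{h. h < ?P \<and> \<not> (\<exists>x. int ?P dvd x \<and> \<bar>x - int h\<bar> \<le> int K)}.
            \<Prod>n\<in>C. \<bar>cos (pi * real h / real n)\<bar>)
     \<le> real ?P * exp (- k * F) + real (2 * (2 * K + 1)) * ((1 + real N * exp (- k * t)) ^ card Q - 1)"
    unfolding k_def
  proof (rule minor_arcs_sum_le[OF finite_C _ Lcm_pos finite_Q])
    show "0 < n \<and> n \<le> N" if "n \<in> C" for n using that C_subset A_pos by auto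
    show "0 < q \<and> q \<le> N" if "q \<in> Q" for q using that Q_subset by (auto simp: primes_in_def prime_gt_0_nat)
    show "F \<le> real (card (misses K C (int h))) \<or>
       (\<exists>x U. \<bar>x - int h\<bar> \<le> int K \<and> U \<subseteq> Q \<and> int ?P dvd x * int (\<Prod>U) \<and>
               t * real (card U) \<le> real (card (misses K C (int h))))" for h
      unfolding t_def by (rule misses_dichotomy)
  qed
  also have "\<dots> < 1 / 2 + 1 / 2"
  proof (rule add_strict_mono)
    have "real ?P * exp (- k * F) \<le> exp (2 * real Z * ln (real N)) * exp (- k * F)"
      by (intro mult_right_mono Lcm_le[OF S SZ ZN]) auto
    also have "\<dots> = exp (2 * real Z * ln (real N) - k * F)"
      by (simp add: exp_add[symmetric])
    also have "\<dots> \<le> exp (- 1)" using num1 by (simp add: k_def)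
    also have "\<dots> < 1 / 2"
    proof -
      have "2 < exp (1::real)" using exp_lower_Taylor_quadratic[of "1::real"] by simp
      then show ?thesis by (simp add: exp_minus field_simps)
    qed
    finally show "real ?P * exp (- k * F) < 1 / 2" .
    define c where "c = real N * exp (- k * t)"
    have N0: "real N \<ge> 5" using N5 by simp
    define i where "i = inverse (real N)"
    have i: "0 < i" "i \<le> 1 / 5" "real N * i = 1" using N0 by (auto simp: i_def field_simps)
    have cancel: "real N * i ^ Suc m = i ^ m" for m
      using i(3) by (simp add: mult.assoc[symmetric])
    have "exp (- k * t) \<le> exp (- (5 * ln (real N)))"
      using num2 by (simp add: k_def t_def)
    also have "\<dots> = exp (- ln (real N)) ^ 5"
      by (simp add: exp_of_nat_mult[symmetric])
    also have "\<dots> = i ^ 5"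
      using N0 by (simp add: exp_minus i_def)
    finally have "c \<le> real N * i ^ 5"
      unfolding c_def by (intro mult_left_mono) auto
    then have c: "c \<le> i ^ 4" using cancel[of 4] by simp
    have c0: "c \<ge> 0" by (simp add: c_def)
    have Nc: "real N * c \<le> i ^ 3"
    proof -
      have "real N * c \<le> real N * i ^ 4" using c by (intro mult_left_mono) auto
      then show ?thesis using cancel[of 3] by simp
    qed
    have "i ^ 3 \<le> 1" using i by (intro power_le_one) auto
    then have Nc1: "real N * c \<le> 1" using Nc by linarith
    have "(1 + c) ^ card Q \<le> exp c ^ card Q"
      using c0 by (intro power_mono) auto
    also have "\<dots> = exp (real (card Q) * c)" by (simp add: exp_of_nat_mult)
    also have "\<dots> \<le> exp (real N * c)"
    proof -
      have "card Q \<le> card {1..N}"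
        using Q_subset by (intro card_mono) (auto simp: primes_in_def prime_ge_1_nat dest!: subsetD)
      then show ?thesis using c0 by (simp add: mult_right_mono)
    qed
    also have "\<dots> \<le> 1 + 2 * (real N * c)"
    proof -
      have "exp (real N * c) \<le> 1 + real N * c + (real N * c)\<^sup>2"
        using Nc1 c0 by (intro exp_bound) auto
      moreover have "(real N * c)\<^sup>2 \<le> real N * c"
        using Nc1 c0 by (simp add: power2_eq_square mult_left_le)
      ultimately show ?thesis by linarith
    qed
    finally have "(1 + c) ^ card Q - 1 \<le> 2 * i ^ 3" using Nc by linarith
    then have "real (2 * (2 * K + 1)) * ((1 + c) ^ card Q - 1) \<le> real (2 * (2 * K + 1)) * (2 * i ^ 3)"
      by (intro mult_left_mono) auto
    also have "\<dots> \<le> (4 * real N) * (2 * i ^ 3)"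
      using K_bound N0 i(1) by (intro mult_right_mono) auto
    also have "\<dots> = 8 * (real N * i ^ 3)" by simp
    also have "\<dots> = 8 * i ^ 2" using cancel[of 2] by (simp add: numeral_3_eq_3)
    also have "\<dots> \<le> 8 * (1 / 5) ^ 2"
      using i by (intro mult_left_mono power_mono) auto
    also have "\<dots> < 1 / 2" by (simp add: power2_eq_square)
    finally show "real (2 * (2 * K + 1)) * ((1 + real N * exp (- k * t)) ^ card Q - 1) < 1 / 2"
      unfolding c_def .
  qed
  finally have minor: "(\<Sum>h\<in>{h. h < ?P \<and> \<not> (\<exists>x. int ?P dvd x \<and> \<bar>x - int h\<bar> \<le> int K)}.
            \<Prod>n\<in>C. \<bar>cos (pi * real h / real n)\<bar>) < 1" by simp
  have "\<exists>S\<subseteq>C. recip_sum B + recip_sum S \<in> \<int>"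
  proof (rule exists_integer_subsum[OF finite_C _ Lcm_pos _ _ near minor])
    show "0 < n \<and> n dvd ?P" if "n \<in> C" for n using that C_subset A_pos nP by auto
    have "recip_sum B * real ?P = (\<Sum>n\<in>B. real ?P / real n)"
      by (simp add: recip_sum_def sum_distrib_right)
    also have "\<dots> \<in> \<int>"
      using B nP by (intro Ints_sum) (auto simp: real_of_nat_div[symmetric])
    finally show "recip_sum B * real ?P \<in> \<int>" .
    show "2 * K \<le> n" if "n \<in> C" for n
    proof -
      have n: "n \<in> A" using that C_subset by auto
      have "rough_part y n \<le> n" using dvd_rough[OF n] A_pos[OF n] by (intro dvd_imp_le) auto
      then show ?thesis using rough_gt[OF n] by linarith
    qed
  qed
  then obtain S' where S': "S' \<subseteq> C" "recip_sum B + recip_sum S' \<in> \<int>" by blast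
  have finB: "finite B" using B finite_A by (meson finite_Diff finite_subset)
  have "recip_sum S' \<le> recip_sum C"
    unfolding recip_sum_def using S' finite_C by (intro sum_mono2) auto
  moreover have "0 \<le> recip_sum S'" unfolding recip_sum_def by (intro sum_nonneg) auto
  ultimately have "0 < recip_sum B + recip_sum S'" "recip_sum B + recip_sum S' < 2"
    using B_pos BC by linarith+
  moreover obtain z :: int where "recip_sum B + recip_sum S' = of_int z" using S' by (auto elim: Ints_cases)
  ultimately have "recip_sum B + recip_sum S' = 1" by simp
  moreover have "recip_sum (B \<union> S') = recip_sum B + recip_sum S'"
    unfolding recip_sum_def using finB S' finite_C B
    by (intro sum.union_disjoint) (auto dest: finite_subset)
  ultimately show ?thesis using B S' C_subset by (intro exI[of _ "B \<union> S'"]) auto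
qed

end

section \<open>Scales and nice integers\<close>

lemma card_exists_dvd_le:
  assumes "finite P" "\<And>p. p \<in> P \<Longrightarrow> 0 < f p"
  shows "real (card {n \<in> {1..N}. \<exists>p\<in>P. f p dvd n}) \<le> real N * (\<Sum>p\<in>P. 1 / real (f p))"
proof -
  have "{n \<in> {1..N}. \<exists>p\<in>P. f p dvd n} = (\<Union>p\<in>P. {n \<in> {1..N}. f p dvd n})" by auto
  then have "card {n \<in> {1..N}. \<exists>p\<in>P. f p dvd n} \<le> (\<Sum>p\<in>P. card {n \<in> {1..N}. f p dvd n})"
    using card_UN_le[OF assms(1), of "\<lambda>p. {n \<in> {1..N}. f p dvd n}"] by simp
  then have "real (card {n \<in> {1..N}. \<exists>p\<in>P. f p dvd n}) \<le> (\<Sum>p\<in>P. real (card {n \<in> {1..N}. f p dvd n}))"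
    by (simp only: of_nat_le_iff of_nat_sum[symmetric])
  also have "\<dots> \<le> (\<Sum>p\<in>P. real N / real (f p))"
    using assms by (intro sum_mono card_multiples_le)
  finally show ?thesis by (simp add: sum_distrib_left)
qed

lemma ln_le_of_less_Suc_power:
  fixes w N H :: nat
  assumes w: "3 \<le> w" and N: "0 < N" "N < (w + 1) ^ H"
  shows "ln (real N) \<le> 2 * real H * ln (real w)"
proof -
  have "3 * w \<le> w * w" using w by (rule mult_le_mono1)
  then have "w + 1 \<le> w ^ 2" using w unfolding power2_eq_square by linarith
  then have "(w + 1) ^ H \<le> (w ^ 2) ^ H" by (rule power_mono) simp
  then have "N \<le> w ^ (2 * H)" using N by (simp add: power_mult)
  then have "real N \<le> real w ^ (2 * H)" by (metis of_nat_le_iff of_nat_power)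
  then have "ln (real N) \<le> ln (real w ^ (2 * H))"
    using N w by (subst ln_le_cancel_iff) auto
  also have "\<dots> = 2 * real H * ln (real w)" using w by (simp add: ln_realpow)
  finally show ?thesis .
qed

text \<open>
All sizes are powers of \<open>w\<close>, roughly the \<open>H\<close>-th root of \<open>N\<close>: smooth means free of primes above \<open>w ^ M\<close>, smooth
parts are allowed up to \<open>w ^ s\<close>, and prime factors up to about \<open>N / w ^ d\<close>.

The exponents come from two kinds of constraints. For the proportion of deleted integers to be small
compared with \<open>\<epsilon>\<close>, the ratios \<open>s / M\<close> and \<open>H / d\<close> have to be large, and the primes between \<open>w\<close> and \<open>w ^ M\<close> need
a large reciprocal sum; \<open>D\<close> measures all three. For the circle method, the rough part of an element is of
order at least \<open>N / w ^ s\<close>, so the window \<open>K\<close> is taken as \<open>N / w ^ (s + 1)\<close>, and a miss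
lowers the logarithm of a term by about \<open>(K / N)\<^sup>2\<close>, which is \<open>w ^ (- 2 s - 2)\<close>. Pruning the at most
\<open>w ^ s\<close> smooth parts at the threshold \<open>T\<close> is cheap for
\<open>T = N / w ^ (s + 1)\<close>, and \<open>F = T / w\<close> misses are few in comparison. The least common multiple has
logarithm about \<open>Z ln N\<close>, which must be beaten by \<open>(K / N)\<^sup>2 F\<close>, about \<open>N / w ^ (3 s + 4)\<close>. This is the reason for
\<open>d = 3 s + 5\<close>.

The last assumptions say that \<open>w\<close> is large in terms of the constants, where \<open>L\<close> is of order \<open>ln w\<close>.
\<close>

locale scales =
  fixes \<epsilon> \<eta> \<mu> :: real and D M s d H m w N L :: nat
  assumes eps: "0 < \<epsilon>" "\<epsilon> < 1 / 2"
    and D_large: "200 \<le> \<epsilon> * real D"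
    and M_eq: "M = 64 ^ D" and s_eq: "s = D * M" and d_eq: "d = 3 * s + 5" and H_eq: "H = D * d"
    and eta_eq: "\<eta> = \<epsilon>\<^sup>2 / (600 * real H)"
    and mu_eq: "\<mu> = 6 * exp (6 * real H) / \<eta>"
    and m_large: "2 * \<mu> + 1 < real m / 2"
    and w_ge: "3 \<le> w" and N_ge: "w ^ H \<le> N" and N_less: "N < (w + 1) ^ H"
    and L_bounds: "N < 2 ^ L" "3 \<le> L"
    and w_L: "L ^ (64 ^ m) \<le> w"
    and w_eta: "80 * real H * real L * ln (real w) \<le> \<eta> * real w"
    and w_eps: "600 * real H \<le> \<epsilon> * real w" "300 \<le> \<epsilon>\<^sup>2 * real w"
begin

definition y :: nat where "y = w ^ M"
definition S :: nat where "S = w ^ s"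
definition Z :: nat where "Z = N div w ^ d"
definition K :: nat where "K = N div w ^ (s + 1)"
definition T :: real where "T = real N / real w ^ (s + 1)"
definition F :: real where "F = real N / real w ^ (s + 2)"

text \<open>
A squarefree rough part is the product of its primes, so divisibility by it can be tested prime by prime.
The lower bound on the integers makes their reciprocals \<open>O(1/N)\<close>.
\<close>

definition nice :: "nat set" where
  "nice = {n \<in> {1..N}. \<epsilon> / 20 * real N < real n \<and> w \<le> smooth_part y n \<and> smooth_part y n \<le> S \<and>
     (\<forall>p. prime p \<longrightarrow> p dvd n \<longrightarrow> p \<le> Z) \<and> (\<forall>p. prime p \<longrightarrow> y < p \<longrightarrow> \<not> p\<^sup>2 dvd n)}"

lemma D_ge: "400 \<le> D"
proof -
  have "200 \<le> real D * \<epsilon>" using D_large by (simp add: mult.commute)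
  also have "\<dots> \<le> real D * (1 / 2)" using eps by (intro mult_left_mono) auto
  finally show ?thesis by simp
qed

lemma M_ge: "1 \<le> M" "64 \<le> M"
proof -
  have "64 ^ 1 \<le> (64::nat) ^ D" using D_ge by (intro power_increasing) auto
  then show "64 \<le> M" by (simp add: M_eq)
  then show "1 \<le> M" by simp
qed

lemma s_ge: "400 \<le> s" "M \<le> s"
  using mult_le_mono[OF D_ge M_ge(1)] D_ge by (auto simp: s_eq)

lemma H_ge: "400 * d \<le> H"
  using mult_le_mono1[OF D_ge, of d] by (simp add: H_eq)

lemma exponents: "s + d \<le> H" "s + 2 \<le> H" "M \<le> H" "2 * d + 2 \<le> H" "1 \<le> H"
  using H_ge s_ge d_eq by auto

lemma ln_w: "1 \<le> ln (real w)"
  using ln_ge_one_nat[OF w_ge] .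

lemma w_pos: "0 < w"
  using w_ge by simp

lemma pow_le_N: "j \<le> H \<Longrightarrow> w ^ j \<le> N"
  using power_increasing[of j H w] w_ge N_ge by linarith

lemma N_pos: "0 < N"
  using pow_le_N[of 0] by simp

lemma w_le_N: "w \<le> N"
  using pow_le_N[of 1] exponents by simp

lemma ln_N: "ln (real N) \<le> 2 * real H * ln (real w)"
  using ln_le_of_less_Suc_power[OF w_ge N_pos N_less] .

lemma ln_N_ge: "1 \<le> ln (real N)"
proof -
  have "ln (real w) \<le> ln (real N)" using w_le_N w_pos by simp
  then show ?thesis using ln_w by linarith
qed

lemma eta_pos: "0 < \<eta>" "\<eta> \<le> 1" "6 * real H * \<eta> = \<epsilon>\<^sup>2 / 100"
proof -
  have H: "real H \<ge> 1" using exponents by simp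
  then show "0 < \<eta>" using eps by (simp add: eta_eq)
  have "\<epsilon>\<^sup>2 \<le> 1\<^sup>2" using eps by (intro power_mono) auto
  then show "\<eta> \<le> 1" using H by (simp add: eta_eq divide_le_eq)
  show "6 * real H * \<eta> = \<epsilon>\<^sup>2 / 100" using H by (simp add: eta_eq)
qed

lemma y_ge: "w \<le> y" "y \<le> N" "2 \<le> y"
proof -
  show "w \<le> y" using M_ge w_pos by (simp add: y_def self_le_power)
  then show "2 \<le> y" using w_ge by simp
  show "y \<le> N" unfolding y_def using exponents by (intro pow_le_N) auto
qed

lemma sum_primes_le: "(\<Sum>p\<in>primes_in y N. 1 / real p) \<le> 6 * real H"
proof -
  have lny: "ln (real y) = real M * ln (real w)"
    using w_pos by (simp add: y_def ln_realpow)
  have lny1: "1 \<le> ln (real y)"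
    unfolding lny using M_ge ln_w mult_mono[of 1 "real M" 1 "ln (real w)"] by simp
  have "(\<Sum>p\<in>primes_in y N. 1 / real p) \<le> (2 * ln (real N / real y) + 2) / ln (real y)"
    using y_ge by (intro sum_inverse_primes_le)
  also have "\<dots> \<le> 6 * real H"
  proof -
    have "ln (real N / real y) \<le> ln (real N)"
      using N_pos y_ge lny1 by (simp add: ln_div)
    then have "2 * ln (real N / real y) + 2 \<le> 4 * real H * ln (real w) + 2" using ln_N by linarith
    also have "\<dots> \<le> 6 * real H * ln (real w)"
      using mult_mono[of 1 "real H" 1 "ln (real w)"] exponents ln_w by simp
    also have "\<dots> \<le> 6 * real H * ln (real y)"
      unfolding lny using M_ge ln_w by (intro mult_left_mono) (auto simp: mult_le_cancel_right1)
    finally show ?thesis using lny1 by (simp add: divide_le_eq)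
  qed
  finally show ?thesis .
qed

lemma div_power_bounds:
  assumes j: "j \<le> H"
  shows "w ^ (H - j) \<le> N div w ^ j" "0 < N div w ^ j"
    "real (N div w ^ j) \<le> real N / real w ^ j" "real N / real w ^ j \<le> 2 * real (N div w ^ j)"
proof -
  have H: "w ^ H = w ^ (H - j) * w ^ j" using j by (simp add: power_add[symmetric])
  show ge: "w ^ (H - j) \<le> N div w ^ j"
    using N_ge w_pos H by (simp add: less_eq_div_iff_mult_less_eq)
  then show pos: "0 < N div w ^ j" using w_pos by (metis gr0I le_zero_eq power_not_zero less_irrefl)
  show "real (N div w ^ j) \<le> real N / real w ^ j"
    using of_nat_div_le_of_nat[of N "w ^ j"] by simp
  have "N = N div w ^ j * w ^ j + N mod w ^ j" by (simp only: div_mult_mod_eq)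
  moreover have "N mod w ^ j < w ^ j" using w_pos by simp
  moreover have "w ^ j \<le> N div w ^ j * w ^ j" using pos by simp
  ultimately have "N \<le> 2 * (N div w ^ j) * w ^ j" by linarith
  then have "real N \<le> 2 * real (N div w ^ j) * real w ^ j"
    by (metis of_nat_le_iff of_nat_mult of_nat_numeral of_nat_power)
  then show "real N / real w ^ j \<le> 2 * real (N div w ^ j)"
    using w_pos by (simp add: divide_le_eq)
qed

lemma Z_bounds: "w ^ (H - d) \<le> Z" "real Z \<le> real N / real w ^ d" "real N / real w ^ d \<le> 2 * real Z"
    "Z \<le> N" "S \<le> Z" "0 < Z"
proof -
  have d: "d \<le> H" using exponents by simp
  show Z1: "w ^ (H - d) \<le> Z" "real Z \<le> real N / real w ^ d" "real N / real w ^ d \<le> 2 * real Z" "0 < Z"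
    unfolding Z_def by (rule div_power_bounds[OF d])+
  show "Z \<le> N" by (simp add: Z_def)
  have "w ^ s \<le> w ^ (H - d)" using exponents w_ge by (intro power_increasing) auto
  then show "S \<le> Z" using Z1(1) by (simp add: S_def)
qed

lemma inverse_D: "1 / real D \<le> \<epsilon> / 200"
proof -
  have "real D > 0" using D_ge by simp
  then show ?thesis using D_large by (simp add: pos_divide_le_eq)
qed

text \<open>
The primes between \<open>Z\<close> and \<open>N\<close> cover only a proportion of about \<open>d / H\<close> on a logarithmic scale.
\<close>

lemma card_large_prime_le:
  "real (card {n \<in> {1..N}. \<exists>p\<in>primes_in Z N. p dvd n}) \<le> real N * (\<epsilon> * 6 / 200)"
proof -
  have "real (card {n \<in> {1..N}. \<exists>p\<in>primes_in Z N. p dvd n}) \<le> real N * (\<Sum>p\<in>primes_in Z N. 1 / real p)"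
    by (intro card_exists_dvd_le) (auto simp: primes_in_def prime_gt_0_nat)
  also have "\<dots> \<le> real N * (\<epsilon> * 6 / 200)"
  proof (rule mult_left_mono)
    have lnZ: "real (H - d) * ln (real w) \<le> ln (real Z)"
    proof -
      have "real w ^ (H - d) \<le> real Z" using Z_bounds(1) by (metis of_nat_le_iff of_nat_power)
      then have "ln (real w ^ (H - d)) \<le> ln (real Z)" using w_pos Z_bounds(6) by simp
      then show ?thesis using w_pos by (simp add: ln_realpow)
    qed
    have Hd: "real H / 2 \<le> real (H - d)" using exponents by linarith
    then have lnZ2: "real H / 2 * ln (real w) \<le> ln (real Z)"
      using lnZ ln_w mult_right_mono[OF Hd, of "ln (real w)"] by linarith
    have H2: "1 \<le> real H / 2" using exponents d_eq by linarith
    have lnZ0: "0 < ln (real Z)"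
      using lnZ2 mult_mono[OF H2 ln_w] H2 by linarith
    then have Z2: "2 \<le> Z" using Z_bounds(6) by (cases "Z = 1") auto
    have lnNZ: "ln (real N / real Z) \<le> (real d + 1) * ln (real w)"
    proof -
      have "real N \<le> 2 * real w ^ d * real Z"
        using Z_bounds(3) w_pos by (simp add: pos_divide_le_eq mult_ac)
      also have "\<dots> \<le> real w * real w ^ d * real Z"
        using w_ge by (intro mult_right_mono) auto
      finally have "real N / real Z \<le> real w ^ (d + 1)" using Z_bounds(6) by (simp add: divide_le_eq)
      then have "ln (real N / real Z) \<le> ln (real w ^ (d + 1))"
        using N_pos Z_bounds(6) by (subst ln_le_cancel_iff) (auto simp: w_pos)
      also have "\<dots> = real (d + 1) * ln (real w)" by (rule ln_realpow)
      finally show ?thesis by (simp add: add.commute)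
    qed
    have "(\<Sum>p\<in>primes_in Z N. 1 / real p) \<le> (2 * ln (real N / real Z) + 2) / ln (real Z)"
      using Z2 Z_bounds by (intro sum_inverse_primes_le)
    also have "\<dots> \<le> (2 * ((real d + 1) * ln (real w)) + 2 * ln (real w)) / ln (real Z)"
      using lnNZ ln_w lnZ0 by (intro divide_right_mono) auto
    also have "\<dots> \<le> (2 * ((real d + 1) * ln (real w)) + 2 * ln (real w)) / (real H / 2 * ln (real w))"
      using lnZ2 lnZ0 ln_w H2 by (intro divide_left_mono mult_pos_pos) auto
    also have "\<dots> = (4 * real d + 8) / real H"
      using ln_w H2 by (simp add: field_simps)
    also have "\<dots> \<le> 6 * real d / real H"
      using d_eq H2 by (intro divide_right_mono) auto
    also have "\<dots> = 6 * (1 / real D)"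
    proof -
      have "0 < real d" using d_eq by simp
      then show ?thesis by (simp add: H_eq)
    qed
    also have "\<dots> \<le> 6 * (\<epsilon> / 200)" using inverse_D by simp
    finally show "(\<Sum>p\<in>primes_in Z N. 1 / real p) \<le> \<epsilon> * 6 / 200" by simp
  qed simp
  finally show ?thesis .
qed

lemma card_square_le:
  "real (card {n \<in> {1..N}. \<exists>p\<in>primes_in y N. p\<^sup>2 dvd n}) \<le> real N * (\<epsilon> / 100)"
proof -
  have "real (card {n \<in> {1..N}. \<exists>p\<in>primes_in y N. p\<^sup>2 dvd n}) \<le> real N * (\<Sum>p\<in>primes_in y N. 1 / real (p\<^sup>2))"
    by (intro card_exists_dvd_le) (auto simp: primes_in_def prime_gt_0_nat)
  also have "\<dots> \<le> real N * (\<Sum>p\<in>primes_in y N. 1 / real w * (1 / real p))"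
  proof (intro mult_left_mono sum_mono)
    fix p assume p: "p \<in> primes_in y N"
    then have "real w \<le> real p" using y_ge by (auto simp: primes_in_def)
    then have "real w * real p \<le> real p * real p" by (intro mult_right_mono) auto
    then have "1 / (real p * real p) \<le> 1 / (real w * real p)"
      using w_pos primes_inD[OF p] by (intro divide_left_mono) auto
    then show "1 / real (p\<^sup>2) \<le> 1 / real w * (1 / real p)"
      by (simp add: power2_eq_square)
  qed simp
  also have "\<dots> = real N * (1 / real w * (\<Sum>p\<in>primes_in y N. 1 / real p))"
    by (simp only: sum_distrib_left)
  also have "\<dots> \<le> real N * (1 / real w * (6 * real H))"
    by (intro mult_left_mono sum_primes_le) auto
  also have "\<dots> \<le> real N * (\<epsilon> / 100)"
    using w_eps(1) w_pos by (intro mult_left_mono) (auto simp: field_simps)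
  finally show ?thesis .
qed

lemma card_large_smooth_le:
  "real (card {n \<in> {1..N}. real (smooth_part y n) > real S}) \<le> real N * (\<epsilon> * 8 / 200)"
proof -
  have lnS: "ln (real S) = real s * ln (real w)" "ln (real y) = real M * ln (real w)"
    using w_pos by (simp_all add: S_def y_def ln_realpow)
  have S1: "1 < real S"
    using w_ge s_ge by (simp add: S_def one_less_power)
  have "real (card {n \<in> {1..N}. real (smooth_part y n) > real S}) \<le> real N * (4 * (ln (real y) + 1) / ln (real S))"
    using y_ge S1 by (intro card_large_smooth_part) auto
  also have "\<dots> \<le> real N * (\<epsilon> * 8 / 200)"
  proof (rule mult_left_mono)
    have "ln (real y) + 1 \<le> 2 * (real M * ln (real w))"
      unfolding lnS using mult_mono[of 1 "real M" 1 "ln (real w)"] M_ge ln_w by simp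
    then have "4 * (ln (real y) + 1) / ln (real S) \<le> 8 * (real M * ln (real w)) / (real s * ln (real w))"
      unfolding lnS using ln_w by (intro divide_right_mono) auto
    also have "\<dots> = 8 * (1 / real D)" using M_ge ln_w by (simp add: s_eq)
    also have "\<dots> \<le> 8 * (\<epsilon> / 200)" using inverse_D by simp
    finally show "4 * (ln (real y) + 1) / ln (real S) \<le> \<epsilon> * 8 / 200" by simp
  qed simp
  finally show ?thesis .
qed

text \<open>
A prime factor between \<open>w\<close> and \<open>y\<close> makes the smooth part at least \<open>w\<close>, and by Turan's sieve almost all
integers have such a prime factor.
\<close>

lemma card_small_smooth_le:
  "real (card {n \<in> {1..N}. smooth_part y n < w}) \<le> real N * (\<epsilon> * 6 / 200)"
proof -
  let ?\<sigma> = "\<Sum>r\<in>primes_in w y. 1 / real r"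
  have \<sigma>: "?\<sigma> \<ge> real D / 2"
  proof -
    have "y = w ^ (64 ^ D)" by (simp only: y_def M_eq[symmetric])
    then show ?thesis using sum_inverse_primes_ge[OF w_ge, of D] by simp
  qed
  have D0: "real D > 0" using D_ge by simp
  have "card {n \<in> {1..N}. smooth_part y n < w} \<le> card {n \<in> {1..N}. \<forall>r\<in>primes_in w y. \<not> r dvd n}"
  proof (rule card_mono)
    show "{n \<in> {1..N}. smooth_part y n < w} \<subseteq> {n \<in> {1..N}. \<forall>r\<in>primes_in w y. \<not> r dvd n}"
    proof safe
      fix n r assume n: "n \<in> {1..N}" "smooth_part y n < w" and r: "r \<in> primes_in w y" "r dvd n"
      have "r \<in> {p \<in> prime_factors n. p \<le> y}"
        using n r by (auto simp: primes_in_def prime_factors_dvd)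
      then have "r ^ multiplicity r n dvd smooth_part y n"
        unfolding smooth_part_def by (intro dvd_prodI) auto
      moreover have "r dvd r ^ multiplicity r n"
        using n r by (intro dvd_power) (auto simp: primes_in_def prime_multiplicity_gt_zero_iff)
      ultimately have "r \<le> smooth_part y n"
        using smooth_part_pos[of n y] n by (meson atLeastAtMost_iff dvd_imp_le dvd_trans less_le_trans zero_less_one)
      then show False using n r by (auto simp: primes_in_def)
    qed
  qed simp
  then have "real (card {n \<in> {1..N}. smooth_part y n < w}) \<le> real (card {n \<in> {1..N}. \<forall>r\<in>primes_in w y. \<not> r dvd n})"
    by simp
  also have "\<dots> \<le> 3 * real N / ?\<sigma>"
  proof (rule Turan_sieve)
    have "card (primes_in w y) \<le> card {1..N}"
      using y_ge by (intro card_mono) (auto simp: primes_in_def prime_ge_1_nat)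
    then show "card (primes_in w y) \<le> N" by simp
    show "0 < ?\<sigma>" using \<sigma> D0 by linarith
  qed (auto simp: primes_in_def)
  also have "\<dots> \<le> 3 * real N / (real D / 2)"
    using \<sigma> D0 by (intro divide_left_mono) auto
  also have "\<dots> = real N * (6 * (1 / real D))" by simp
  also have "\<dots> \<le> real N * (6 * (\<epsilon> / 200))"
    using inverse_D by (intro mult_left_mono) auto
  finally show ?thesis by simp
qed

lemma card_not_nice_le: "real (card ({1..N} - nice)) \<le> \<epsilon> * 16 / 100 * real N"
proof -
  let ?A1 = "{1..nat \<lfloor>\<epsilon> / 20 * real N\<rfloor>}"
  let ?A2 = "{n \<in> {1..N}. \<exists>p\<in>primes_in Z N. p dvd n}"
  let ?A3 = "{n \<in> {1..N}. \<exists>p\<in>primes_in y N. p\<^sup>2 dvd n}"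
  let ?A4 = "{n \<in> {1..N}. real (smooth_part y n) > real S}"
  let ?A5 = "{n \<in> {1..N}. smooth_part y n < w}"
  have "{1..N} - nice \<subseteq> ?A1 \<union> (?A2 \<union> (?A3 \<union> (?A4 \<union> ?A5)))"
  proof
    fix n assume n: "n \<in> {1..N} - nice"
    then consider "real n \<le> \<epsilon> / 20 * real N" | "smooth_part y n < w" | "S < smooth_part y n"
      | p where "prime p" "p dvd n" "Z < p" | p where "prime p" "y < p" "p\<^sup>2 dvd n"
      unfolding nice_def by (auto simp: not_le not_less)
    then show "n \<in> ?A1 \<union> (?A2 \<union> (?A3 \<union> (?A4 \<union> ?A5)))"
    proof cases
      case 1
      then have "n \<in> ?A1" using n by (simp add: le_nat_floor)
      then show ?thesis by blast
    next
      case (4 p)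
      then have "p \<le> N" using n by (auto dest: dvd_imp_le)
      then show ?thesis using 4 n by (auto simp: primes_in_def)
    next
      case (5 p)
      then have "p dvd n" by (meson dvd_power dvd_trans pos2)
      then have "p \<le> N" using n by (auto dest: dvd_imp_le)
      then show ?thesis using 5 n by (auto simp: primes_in_def)
    qed (use n in auto)
  qed
  then have "card ({1..N} - nice) \<le> card (?A1 \<union> (?A2 \<union> (?A3 \<union> (?A4 \<union> ?A5))))"
    by (rule card_mono[rotated]) auto
  also have "\<dots> \<le> card ?A1 + (card ?A2 + (card ?A3 + (card ?A4 + card ?A5)))"
    by (intro order_trans[OF card_Un_le] add_left_mono card_Un_le)
  finally have "real (card ({1..N} - nice)) \<le>
      real (card ?A1) + (real (card ?A2) + (real (card ?A3) + (real (card ?A4) + real (card ?A5))))"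
    by linarith
  also have "\<dots> \<le> \<epsilon> / 20 * real N + (real N * (\<epsilon> * 6 / 200) + (real N * (\<epsilon> / 100) + (real N * (\<epsilon> * 8 / 200) + real N * (\<epsilon> * 6 / 200))))"
  proof (intro add_mono card_large_prime_le card_square_le card_large_smooth_le card_small_smooth_le)
    show "real (card ?A1) \<le> \<epsilon> / 20 * real N"
      using of_nat_floor[of "\<epsilon> / 20 * real N"] eps by simp
  qed
  also have "\<dots> = \<epsilon> * 16 / 100 * real N" by (simp add: algebra_simps)
  finally show ?thesis .
qed

end

section \<open>Dense sets contain a unit sum\<close>

context scales
begin

lemma w_bounds: "80 * real H * real L * ln (real w) \<le> real w" "4 * real L \<le> \<eta> * real w"
  "3 * real L / \<eta> \<le> real w" "24 * real H * ln (real w) \<le> real w" "600 \<le> \<epsilon> * real w" "1 / real w \<le> \<epsilon>\<^sup>2 / 300"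
proof -
  have H: "1 \<le> real H" using exponents by simp
  have L: "1 \<le> real L" using L_bounds by simp
  have Hl: "1 \<le> real H * ln (real w)" using mult_mono[OF H ln_w] H by simp
  have HL: "1 \<le> real H * real L" using mult_mono[OF H L] H by simp
  have "\<eta> * real w \<le> 1 * real w" using eta_pos by (intro mult_right_mono) auto
  then show 1: "80 * real H * real L * ln (real w) \<le> real w" using w_eta by linarith
  have "80 * real L * 1 \<le> 80 * real L * (real H * ln (real w))" using Hl by (intro mult_left_mono) auto
  then have 2: "80 * real L \<le> \<eta> * real w" using w_eta by (simp add: mult_ac)
  then show "4 * real L \<le> \<eta> * real w" using L by linarith
  have "3 * real L \<le> real w * \<eta>" using 2 L by (simp add: mult.commute)
  then show "3 * real L / \<eta> \<le> real w" using eta_pos by (simp add: pos_divide_le_eq)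
  have "24 * (real H * ln (real w)) * 1 \<le> 80 * (real H * ln (real w)) * real L"
    using Hl L ln_w by (intro mult_mono) auto
  then show "24 * real H * ln (real w) \<le> real w" using 1 by (simp add: mult_ac)
  show "600 \<le> \<epsilon> * real w" using w_eps(1) H by linarith
  show "1 / real w \<le> \<epsilon>\<^sup>2 / 300" using w_eps(2) w_pos by (simp add: field_simps)
qed

lemma N_large: "600 \<le> \<epsilon> * real N" "5 \<le> N"
proof -
  have "\<epsilon> * real w \<le> \<epsilon> * real N" using w_le_N eps by (intro mult_left_mono) auto
  then show *: "600 \<le> \<epsilon> * real N" using w_bounds(5) by linarith
  have "\<epsilon> * real N \<le> 1 * real N" using eps by (intro mult_right_mono) auto
  then show "5 \<le> N" using * by linarith
qed

lemma recip_sum_dense: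
  assumes X: "X \<subseteq> {1..N}" and card: "(1 - 1 / exp 1 + 4 / 5 * \<epsilon>) * real N \<le> real (card X)"
  shows "1 + \<epsilon> \<le> recip_sum X"
proof -
  \<comment> \<open>The slack between 4/5 and 3/4 absorbs the summand 1 in \<open>N - |X| + 1\<close>.\<close>
  define \<rho> where "\<rho> = 1 / exp 1 - 3 / 4 * \<epsilon>"
  have e2: "2 \<le> exp (1::real)" using exp_ge_add_one_self[of "1::real"] by simp
  have cN: "real (card X) \<le> real N" using card_mono[OF _ X] by simp
  have "real N - real (card X) + 1 \<le> (1 / exp 1 - 4 / 5 * \<epsilon>) * real N + 1 / 20 * (\<epsilon> * real N)"
    using card N_large(1) by (simp add: algebra_simps)
  also have "\<dots> = \<rho> * real N" by (simp add: \<rho>_def algebra_simps)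
  finally have le: "real N - real (card X) + 1 \<le> \<rho> * real N" .
  then have "0 < \<rho> * real N" using cN by linarith
  then have \<rho>: "0 < \<rho>" using N_pos by (simp add: zero_less_mult_iff)
  have "ln \<rho> = ln (exp 1 * \<rho>) - 1" using \<rho> by (simp add: ln_mult_pos)
  also have "\<dots> \<le> exp 1 * \<rho> - 1 - 1" using \<rho> by (intro diff_right_mono ln_le_minus_one) auto
  also have "\<dots> = - 1 - 3 / 4 * \<epsilon> * exp 1" by (simp add: \<rho>_def algebra_simps)
  also have "\<dots> \<le> - 1 - 3 / 4 * \<epsilon> * 2"
    using e2 eps by (intro diff_left_mono mult_left_mono) auto
  also have "\<dots> \<le> - (1 + \<epsilon>)" using eps by simp
  finally have "1 + \<epsilon> \<le> - ln \<rho>" by simp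
  also have "\<dots> = ln (real N / (\<rho> * real N))" using \<rho> N_pos by (simp add: ln_div)
  also have "\<dots> \<le> ln ((real N + 1) / (real N - real (card X) + 1))"
  proof (subst ln_le_cancel_iff)
    show "real N / (\<rho> * real N) \<le> (real N + 1) / (real N - real (card X) + 1)"
      using le cN by (intro frac_le) auto
  qed (use \<rho> N_pos cN in auto)
  also have "\<dots> \<le> recip_sum X" by (rule recip_sum_ge[OF X])
  finally show ?thesis .
qed

lemma K_bounds: "0 < K" "real K \<le> real N / real w ^ (s + 1)" "real N / real w ^ (s + 1) \<le> 2 * real K" "2 * K \<le> N"
proof -
  have s: "s + 1 \<le> H" using exponents by simp
  show 1: "0 < K" "real K \<le> real N / real w ^ (s + 1)" "real N / real w ^ (s + 1) \<le> 2 * real K"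
    unfolding K_def by (rule div_power_bounds[OF s])+
  have "w \<le> w ^ (s + 1)" using w_ge by (intro self_le_power) auto
  then have "2 \<le> w ^ (s + 1)" using w_ge by linarith
  then have "2 * K \<le> w ^ (s + 1) * K" by (rule mult_le_mono1)
  also have "\<dots> \<le> N" unfolding K_def by simp
  finally show "2 * K \<le> N" .
qed

lemma window_ratio_ge: "1 / (4 * real w ^ (2 * s + 2)) \<le> (real K / real N)\<^sup>2"
proof -
  have "real w ^ (s + 1) > 0" using w_pos by simp
  then have "1 / (2 * real w ^ (s + 1)) \<le> real K / real N"
    using K_bounds(3) N_pos by (simp add: field_simps)
  then have "(1 / (2 * real w ^ (s + 1)))\<^sup>2 \<le> (real K / real N)\<^sup>2"
    by (intro power_mono) auto
  moreover have "(1 / (2 * real w ^ (s + 1)))\<^sup>2 = 1 / (4 * real w ^ (2 * s + 2))"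
  proof -
    have e: "2 * s + 2 = (s + 1) * 2" by simp
    show ?thesis unfolding e power_mult by (simp add: power_divide power_mult_distrib)
  qed
  ultimately show ?thesis by linarith
qed

text \<open>
A frequency that misses \<open>F\<close> elements is negligible against the number \<open>Lcm A\<close> of all frequencies.
\<close>

lemma large_arc_bound: "2 * real Z * ln (real N) + 1 \<le> (real K / real N)\<^sup>2 * F"
proof -
  have Z1: "1 \<le> real Z" using Z_bounds(6) by simp
  have "1 \<le> real Z * ln (real N)" using mult_mono[OF Z1 ln_N_ge] Z1 by simp
  then have "2 * real Z * ln (real N) + 1 \<le> real Z * (3 * ln (real N))" by (simp add: algebra_simps)
  also have "\<dots> \<le> real Z * (real w / 4)"
    using ln_N w_bounds(4) by (intro mult_left_mono) auto
  also have "\<dots> \<le> real N / real w ^ d * (real w / 4)"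
    using Z_bounds(2) by (intro mult_right_mono) auto
  also have "\<dots> = 1 / (4 * real w ^ (2 * s + 2)) * F"
  proof -
    have "d = (2 * s + 2) + (s + 2) + 1" by (simp add: d_eq)
    then have "real w ^ d = real w ^ (2 * s + 2) * real w ^ (s + 2) * real w"
      by (simp only: power_add power_one_right)
    then show ?thesis using w_pos by (simp add: F_def)
  qed
  also have "\<dots> \<le> (real K / real N)\<^sup>2 * F"
    using window_ratio_ge by (intro mult_right_mono) (auto simp: F_def)
  finally show ?thesis .
qed

text \<open>
The misses caused by a single prime that does not divide \<open>x\<close> outweigh the number of choices of the
prime and of the frequency.
\<close>

lemma small_arc_bound: "5 * ln (real N) \<le> (real K / real N)\<^sup>2 * (\<eta> * real N / (2 * real Z * real L))"
proof -
  have L: "0 < real L" using L_bounds by simp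
  have "5 * ln (real N) \<le> 10 * real H * ln (real w)" using ln_N by linarith
  also have "\<dots> \<le> \<eta> * real w / (8 * real L)"
    using w_eta L by (simp add: pos_le_divide_eq mult_ac)
  also have "\<dots> \<le> \<eta> * real w ^ (s + 3) / (8 * real L)"
    using eta_pos L w_ge self_le_power[of "real w" "s + 3"]
    by (intro divide_right_mono mult_left_mono) auto
  also have "\<dots> = 1 / (4 * real w ^ (2 * s + 2)) * (\<eta> * real w ^ d / (2 * real L))"
  proof -
    have "d = (2 * s + 2) + (s + 3)" by (simp add: d_eq)
    then have "real w ^ d = real w ^ (2 * s + 2) * real w ^ (s + 3)"
      by (simp only: power_add)
    then show ?thesis using w_pos by simp
  qed
  also have "\<dots> \<le> (real K / real N)\<^sup>2 * (\<eta> * (real N / real Z) / (2 * real L))"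
  proof (rule mult_mono[OF window_ratio_ge])
    have "real w ^ d * real Z \<le> real N" using Z_bounds(2) w_pos by (simp add: pos_le_divide_eq mult.commute)
    then have "real w ^ d \<le> real N / real Z" using Z_bounds(6) by (simp add: pos_le_divide_eq)
    then show "\<eta> * real w ^ d / (2 * real L) \<le> \<eta> * (real N / real Z) / (2 * real L)"
      using eta_pos L by (intro divide_right_mono mult_left_mono) auto
  qed (use eta_pos in auto)
  also have "\<dots> = (real K / real N)\<^sup>2 * (\<eta> * real N / (2 * real Z * real L))" by (simp add: mult_ac)
  finally show ?thesis .
qed

lemma N_over_power_le: "1 \<le> j \<Longrightarrow> real N / real w ^ j \<le> real N * (\<epsilon>\<^sup>2 / 300)"
proof -
  assume j: "1 \<le> j"
  have "real w \<le> real w ^ j" using j w_ge by (intro self_le_power) auto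
  then have "real N / real w ^ j \<le> real N / real w"
    using w_pos by (intro divide_left_mono) auto
  also have "\<dots> = real N * (1 / real w)" by simp
  also have "\<dots> \<le> real N * (\<epsilon>\<^sup>2 / 300)" using w_bounds(6) by (intro mult_left_mono) auto
  finally show ?thesis .
qed

lemma mu_pos: "0 < \<mu>"
  using eta_pos by (simp add: mu_eq)

lemma mu_primes: "2 * \<mu> + 1 < (\<Sum>r\<in>primes_in L w. 1 / real r)"
proof -
  have "real m / 2 \<le> (\<Sum>r\<in>primes_in L (L ^ (64 ^ m)). 1 / real r)"
    by (rule sum_inverse_primes_ge[OF L_bounds(2)])
  also have "\<dots> \<le> (\<Sum>r\<in>primes_in L w. 1 / real r)"
    using w_L by (intro sum_mono2 primes_in_mono) auto
  finally show ?thesis using m_large by linarith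
qed

lemma eta_mu_primes: "6 * (\<Prod>p\<in>primes_in y N. 1 + 1 / real p) \<le> \<eta> * \<mu>"
proof -
  have "(\<Prod>p\<in>primes_in y N. 1 + 1 / real p) \<le> (\<Prod>p\<in>primes_in y N. exp (1 / real p))"
    by (intro prod_mono) auto
  also have "\<dots> = exp (\<Sum>p\<in>primes_in y N. 1 / real p)" by (simp add: exp_sum)
  also have "\<dots> \<le> exp (6 * real H)" using sum_primes_le by simp
  finally show ?thesis using eta_pos by (simp add: mu_eq)
qed

text \<open>
The classes to be pruned are the multiples of a prime between \<open>y\<close> and \<open>Z\<close>, with threshold \<open>\<eta> N / p\<close>, and the
sets of integers with a given smooth part, with threshold \<open>T\<close>. The sum of all thresholds is of order
\<open>\<epsilon>\<^sup>2 N\<close>. It bounds both the number of pruned elements and, up to rounding, the size of the set \<open>C\<close> of representatives;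
therefore \<open>R(C)\<close> is small compared with \<open>\<epsilon>\<close>, and what is left of \<open>A\<close> outside \<open>C\<close> still has enough mass for a
greedy choice of \<open>B\<close>.
\<close>

lemma exists_unit_subsum:
  assumes A: "A \<subseteq> {1..N}" and card_A: "(1 - 1 / exp 1 + \<epsilon>) * real N \<le> real (card A)"
  shows "\<exists>A'\<subseteq>A. recip_sum A' = 1"
proof -
  define A0 where "A0 = A \<inter> nice"
  define J where "J = primes_in y Z <+> {1..S}"
  define cls where "cls = case_sum (\<lambda>p::nat. {n. p dvd n}) (\<lambda>\<sigma>::nat. {n. smooth_part y n = \<sigma>})"
  define t where "t = case_sum (\<lambda>p::nat. \<eta> * real N / real p) (\<lambda>_::nat. T)"
  have finA: "finite A" using A by (rule finite_subset) simp
  have finA0: "finite A0" using finA by (simp add: A0_def)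
  have finJ: "finite J" by (simp add: J_def)
  have T0: "0 \<le> T" by (simp add: T_def)
  have t0: "0 \<le> t i" for i using eta_pos T0 by (simp add: t_def split: sum.split)
  have eps2: "\<epsilon>\<^sup>2 \<le> \<epsilon> / 2" using eps by (simp add: power2_eq_square mult_left_mono)
  have sum_t: "(\<Sum>i\<in>J. t i) \<le> \<epsilon>\<^sup>2 / 75 * real N"
  proof -
    have "(\<Sum>i\<in>J. t i) = (\<Sum>p\<in>primes_in y Z. \<eta> * real N / real p) + (\<Sum>\<sigma>\<in>{1..S}. T)"
      unfolding J_def by (subst sum.Plus) (auto simp: t_def)
    also have "(\<Sum>p\<in>primes_in y Z. \<eta> * real N / real p) \<le> (\<Sum>p\<in>primes_in y N. \<eta> * real N / real p)"
      using Z_bounds eta_pos by (intro sum_mono2 primes_in_mono) auto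
    also have "\<dots> = \<eta> * real N * (\<Sum>p\<in>primes_in y N. 1 / real p)"
      by (simp add: sum_distrib_left)
    also have "\<dots> \<le> \<eta> * real N * (6 * real H)"
      using eta_pos by (intro mult_left_mono sum_primes_le) auto
    also have "\<dots> = (6 * real H * \<eta>) * real N" by simp
    also have "\<dots> = \<epsilon>\<^sup>2 / 100 * real N" unfolding eta_pos(3) ..
    also have "(\<Sum>\<sigma>\<in>{1..S}. T) = real N / real w ^ 1"
      using w_pos by (simp add: S_def T_def)
    also have "\<dots> \<le> real N * (\<epsilon>\<^sup>2 / 300)" by (rule N_over_power_le) simp
    finally show ?thesis by (simp add: algebra_simps)
  qed
  obtain A1 where A1: "A1 \<subseteq> A0" "real (card (A0 - A1)) \<le> (\<Sum>i\<in>J. t i)"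
    "\<forall>i\<in>J. A1 \<inter> cls i = {} \<or> t i \<le> real (card (A1 \<inter> cls i))"
    using prune_classes[where cls = cls and t = t, OF finJ finA0 t0] by blast
  have finA1: "finite A1" using A1(1) finA0 by (rule finite_subset)
  have A1_nice: "A1 \<subseteq> nice" "A1 \<subseteq> A" using A1(1) by (auto simp: A0_def)
  obtain C where C: "C \<subseteq> A1" "real (card C) \<le> (\<Sum>i\<in>J. t i + 1)"
    "\<forall>i\<in>J. A1 \<inter> cls i = {} \<or> t i \<le> real (card (C \<inter> cls i))"
    using select_representatives[where cls = cls and t = t, OF finJ finA1 t0 bspec[OF A1(3)]] by blast
  have finC: "finite C" using C(1) finA1 by (rule finite_subset)
  have card_A1: "(1 - 1 / exp 1 + 4 / 5 * \<epsilon>) * real N \<le> real (card A1)"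
  proof -
    have "A \<subseteq> A1 \<union> ((A0 - A1) \<union> ({1..N} - nice))" using A by (auto simp: A0_def)
    then have "card A \<le> card (A1 \<union> ((A0 - A1) \<union> ({1..N} - nice)))"
      using finA1 finA0 by (intro card_mono) auto
    also have "\<dots> \<le> card A1 + (card (A0 - A1) + card ({1..N} - nice))"
      by (intro order_trans[OF card_Un_le] add_left_mono card_Un_le)
    finally have "real (card A) \<le> real (card A1) + (real (card (A0 - A1)) + real (card ({1..N} - nice)))"
      by linarith
    also have "\<dots> \<le> real (card A1) + (\<epsilon>\<^sup>2 / 75 * real N + \<epsilon> * 16 / 100 * real N)"
      using A1(2) sum_t card_not_nice_le by linarith
    also have "\<dots> \<le> real (card A1) + (\<epsilon> / 25 * real N + \<epsilon> * 16 / 100 * real N)"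
      using eps2 eps by (intro add_left_mono add_right_mono mult_right_mono) auto
    also have "\<dots> = real (card A1) + 1 / 5 * \<epsilon> * real N" by (simp add: algebra_simps)
    finally show ?thesis using card_A by (simp add: algebra_simps)
  qed
  have A1_N: "A1 \<subseteq> {1..N}" using A1_nice A by auto
  have card_A1_half: "real N / 2 \<le> real (card A1)"
  proof -
    have "2 \<le> exp (1::real)" using exp_ge_add_one_self[of "1::real"] by simp
    then have "1 / exp 1 \<le> (1 / 2 :: real)" by (intro divide_left_mono) auto
    then have "1 / 2 \<le> 1 - 1 / exp 1 + 4 / 5 * \<epsilon>" using eps by linarith
    then have "1 / 2 * real N \<le> (1 - 1 / exp 1 + 4 / 5 * \<epsilon>) * real N"
      by (intro mult_right_mono) auto
    then show ?thesis using card_A1 by linarith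
  qed
  have card_C: "real (card C) \<le> \<epsilon>\<^sup>2 / 50 * real N"
  proof -
    have "card J = card (primes_in y Z) + S" by (simp add: J_def card_Plus)
    also have "card (primes_in y Z) \<le> card {1..Z}"
      by (rule card_mono) (auto simp: primes_in_def prime_ge_1_nat)
    also have "card {1..Z} + S \<le> 2 * Z" using Z_bounds(5) by simp
    finally have "real (card J) \<le> 2 * real Z" by linarith
    also have "\<dots> \<le> 2 * (real N * (\<epsilon>\<^sup>2 / 300))"
    proof -
      have "1 \<le> d" using d_eq by linarith
      from N_over_power_le[OF this] Z_bounds(2) show ?thesis by linarith
    qed
    finally have "real (card J) \<le> \<epsilon>\<^sup>2 / 150 * real N" by (simp add: mult.commute)
    moreover have "(\<Sum>i\<in>J. t i + 1) = (\<Sum>i\<in>J. t i) + real (card J)"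
      by (simp add: sum.distrib)
    ultimately show ?thesis using C(2) sum_t by (simp add: algebra_simps)
  qed
  have gt: "\<epsilon> / 20 * real N < real n" if "n \<in> A1" for n
    using that A1_nice by (auto simp: nice_def)
  have N20: "0 < \<epsilon> / 20 * real N" using eps N_pos by simp
  have recip_C: "recip_sum C \<le> 2 / 5 * \<epsilon>"
  proof -
    have "recip_sum C \<le> (\<Sum>n\<in>C. 1 / (\<epsilon> / 20 * real N))"
      unfolding recip_sum_def
    proof (rule sum_mono)
      fix n assume "n \<in> C"
      then have "\<epsilon> / 20 * real N < real n" using gt C(1) by blast
      then show "1 / real n \<le> 1 / (\<epsilon> / 20 * real N)"
        using N20 by (intro divide_left_mono) auto
    qed
    also have "\<dots> = real (card C) / (\<epsilon> / 20 * real N)" by simp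
    also have "\<dots> \<le> (\<epsilon>\<^sup>2 / 50 * real N) / (\<epsilon> / 20 * real N)"
      using card_C N20 by (intro divide_right_mono) auto
    also have "\<dots> = 2 / 5 * \<epsilon>" using eps N_pos by (simp add: power2_eq_square)
    finally show ?thesis .
  qed
  have recip_C0: "0 \<le> recip_sum C" unfolding recip_sum_def by (intro sum_nonneg) auto
  interpret rich_family N y w K L Z A1 C \<eta> \<mu> F T
  proof
    show "A1 \<subseteq> {1..N}" "C \<subseteq> A1" "N < 2 ^ L" "2 * K \<le> N" "K > 0" "Z > 0" "\<eta> > 0" "\<mu> > 0"
      using A1_N C(1) L_bounds K_bounds Z_bounds eta_pos mu_pos by auto
    show "L > 0" using L_bounds by simp
    show "2 * \<mu> + 1 < (\<Sum>r\<in>primes_in L w. 1 / real r)" by (rule mu_primes)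
    show "6 * (\<Prod>p\<in>primes_in y N. 1 + 1 / real p) \<le> \<eta> * \<mu>" by (rule eta_mu_primes)
    show "w \<le> smooth_part y n" if "n \<in> A1" for n
      using that A1_nice by (auto simp: nice_def)
    show "\<not> p\<^sup>2 dvd n" if "n \<in> A1" "prime p" "y < p" for n p
      using that A1_nice by (auto simp: nice_def)
    show "p \<le> Z" if "n \<in> A1" "prime p" "p dvd n" for n p
      using that A1_nice by (auto simp: nice_def)
    show "2 * K < rough_part y n" if n: "n \<in> A1" for n
    proof (rule ccontr)
      assume "\<not> 2 * K < rough_part y n"
      then have rough: "real (rough_part y n) \<le> 2 * real K" by linarith
      have sm: "real (smooth_part y n) \<le> real w ^ s"
        using n A1_nice by (auto simp: nice_def S_def simp flip: of_nat_power)
      have "real n = real (smooth_part y n) * real (rough_part y n)"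
        using smooth_mult_rough[of n y] n A1_N by (auto simp flip: of_nat_mult)
      also have "\<dots> \<le> real w ^ s * (2 * real K)"
        using sm rough by (intro mult_mono) auto
      also have "\<dots> \<le> real w ^ s * (2 * (real N / real w ^ (s + 1)))"
        using K_bounds(2) by (intro mult_left_mono) auto
      also have "\<dots> = 2 * real N / real w" using w_pos by simp
      also have "\<dots> \<le> \<epsilon> / 20 * real N"
      proof -
        have "40 * real N \<le> \<epsilon> * real w * real N" using w_bounds(5) by (intro mult_right_mono) auto
        then show ?thesis using w_pos by (simp add: divide_le_eq mult_ac)
      qed
      finally show False using gt[OF n] by linarith
    qed
    show "\<eta> * real N / real p \<le> real (card {m \<in> C. p dvd m})" if n: "n \<in> A1" and p: "prime p" "y < p" "p dvd n" for n p
    proof -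
      have "p \<le> Z" using n p A1_nice by (auto simp: nice_def)
      then have "Inl p \<in> J" using p by (auto simp: J_def primes_in_def)
      moreover have "n \<in> A1 \<inter> cls (Inl p)" using n p by (simp add: cls_def)
      ultimately have "t (Inl p) \<le> real (card (C \<inter> cls (Inl p)))" using C(3) by blast
      moreover have "C \<inter> cls (Inl p) = {m \<in> C. p dvd m}" by (auto simp: cls_def)
      ultimately show ?thesis by (simp add: t_def)
    qed
    show "T \<le> real (card {m \<in> C. smooth_part y m = smooth_part y n})" if n: "n \<in> A1" for n
    proof -
      have "smooth_part y n \<in> {1..S}" using n A1_nice w_ge by (auto simp: nice_def)
      then have "Inr (smooth_part y n) \<in> J" unfolding J_def by (rule InrI)
      moreover have "n \<in> A1 \<inter> cls (Inr (smooth_part y n))" using n by (simp add: cls_def)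
      ultimately have "t (Inr (smooth_part y n)) \<le> real (card (C \<inter> cls (Inr (smooth_part y n))))" using C(3) by blast
      moreover have "C \<inter> cls (Inr (smooth_part y n)) = {m \<in> C. smooth_part y m = smooth_part y n}" by (auto simp: cls_def)
      ultimately show ?thesis by (simp add: t_def)
    qed
    have L0: "0 < real L" using L_bounds by simp
    have F0: "0 \<le> F" by (simp add: F_def)
    have FT: "F * real w = T" using w_pos by (simp add: F_def T_def)
    show "F \<le> \<eta> * real (card A1) / (2 * real L)"
    proof -
      have "F \<le> real N / real w"
        unfolding F_def using w_ge by (intro divide_left_mono self_le_power) auto
      also have "\<dots> \<le> \<eta> * (real N / 2) / (2 * real L)"
      proof -
        have "4 * real L * real N \<le> \<eta> * real w * real N" using w_bounds(2) by (intro mult_right_mono) auto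
        then show ?thesis using w_pos L0 by (simp add: field_simps)
      qed
      also have "\<dots> \<le> \<eta> * real (card A1) / (2 * real L)"
        using card_A1_half eta_pos L0 by (intro divide_right_mono mult_left_mono) auto
      finally show ?thesis .
    qed
    show "F + 2 * real L * F / \<eta> \<le> T"
    proof -
      have "1 \<le> real L / \<eta>" using eta_pos L_bounds by (simp add: le_divide_eq)
      moreover have "2 * real L / \<eta> = 2 * (real L / \<eta>)" "3 * real L / \<eta> = 3 * (real L / \<eta>)" by simp_all
      ultimately have "1 + 2 * real L / \<eta> \<le> 3 * real L / \<eta>" by linarith
      then have "F * (1 + 2 * real L / \<eta>) \<le> F * (3 * real L / \<eta>)"
        using F0 by (rule mult_left_mono)
      also have "\<dots> \<le> F * real w" using w_bounds(3) F0 by (intro mult_left_mono) auto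
      finally show ?thesis unfolding FT by (simp add: algebra_simps)
    qed
  qed
  \<comment> \<open>An upper bound for the reciprocals of nice integers, hence for the overshoot of the greedy choice.\<close>
  define \<delta> where "\<delta> = 1 / (\<epsilon> / 20 * real N)"
  have \<delta>0: "0 < \<delta>" using N20 by (simp add: \<delta>_def)
  have \<delta>_small: "\<delta> \<le> 1 / 30" using N_large(1) N20 by (simp add: \<delta>_def field_simps)
  have diff: "recip_sum (A1 - C) = recip_sum A1 - recip_sum C"
    unfolding recip_sum_def using C(1) finA1 by (simp add: sum_diff)
  have "\<exists>B\<subseteq>A1 - C. 1 - recip_sum C / 2 \<le> (\<Sum>n\<in>B. 1 / real n) \<and> (\<Sum>n\<in>B. 1 / real n) < 1 - recip_sum C / 2 + \<delta>"
  proof (rule greedy_subsum)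
    show "1 / real n < \<delta>" if "n \<in> A1 - C" for n
      unfolding \<delta>_def using gt[of n] that N20 by (intro divide_strict_left_mono) auto
    show "0 \<le> 1 - recip_sum C / 2" using recip_C eps by linarith
    show "1 - recip_sum C / 2 \<le> (\<Sum>n\<in>A1 - C. 1 / real n)"
      using recip_sum_dense[OF A1_N card_A1] recip_C recip_C0 eps diff unfolding recip_sum_def[of "A1 - C"] by linarith
  qed (use finA1 \<delta>0 in auto)
  then obtain B where B: "B \<subseteq> A1 - C" "1 - recip_sum C / 2 \<le> recip_sum B" "recip_sum B < 1 - recip_sum C / 2 + \<delta>"
    unfolding recip_sum_def[symmetric] by blast
  have "\<exists>A'\<subseteq>A1. recip_sum A' = 1"
  proof (rule exists_recip_sum_eq_1[OF _ Z_bounds(5) Z_bounds(4) N_large(2) B(1) _ _ _ large_arc_bound small_arc_bound])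
    show "smooth_part y n \<le> S" if "n \<in> A1" for n using that A1_nice by (auto simp: nice_def)
    show "0 < recip_sum B" using B(2) recip_C eps by linarith
    show "recip_sum B + recip_sum C < 2" using B(3) recip_C eps \<delta>_small by linarith
    have "\<bar>recip_sum B + recip_sum C / 2 - 1\<bar> * real K \<le> \<delta> * (real N / real w ^ (s + 1))"
      using B K_bounds(2) by (intro mult_mono) auto
    also have "\<dots> \<le> \<delta> * (real N * (\<epsilon>\<^sup>2 / 300))"
      using \<delta>0 by (intro mult_left_mono N_over_power_le) auto
    also have "\<dots> = \<epsilon> / 15" using eps N_pos by (simp add: \<delta>_def power2_eq_square)
    also have "\<dots> \<le> 1 / 4" using eps by simp
    finally show "\<bar>recip_sum B + recip_sum C / 2 - 1\<bar> * real K \<le> 1 / 4" .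
  qed
  then show ?thesis using A1_nice(2) by blast
qed

end

lemma eventually_ln_power_le:
  fixes e :: real
  assumes "0 < e"
  shows "\<forall>\<^sub>F w in sequentially. ln (real w) ^ k \<le> e * real w"
proof -
  have "((\<lambda>x::real. ln x ^ k / exp (ln x)) \<longlongrightarrow> 0) at_top"
    by (rule filterlim_compose[OF tendsto_power_div_exp_0 ln_at_top])
  then have "(\<lambda>w. ln (real w) ^ k / exp (ln (real w))) \<longlonglongrightarrow> 0"
    by (rule filterlim_compose[OF _ filterlim_real_sequentially])
  then have "\<forall>\<^sub>F w in sequentially. ln (real w) ^ k / exp (ln (real w)) < e"
    using assms by (rule order_tendstoD)
  then show ?thesis
    using eventually_gt_at_top[of 0]
    by eventually_elim (simp add: pos_divide_less_eq)
qed

theorem theorem1p3: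
  fixes \<epsilon> :: real
  assumes "0 < \<epsilon>" and "\<epsilon> < 1 / 2"
  shows "\<exists>N\<^sub>0::nat. \<forall>N\<ge>N\<^sub>0. \<forall>A::nat set.
           A \<subseteq> {1..N} \<longrightarrow> real (card A) \<ge> (1 - 1 / exp 1 + \<epsilon>) * real N \<longrightarrow>
             (\<exists>A'\<subseteq>A. (\<Sum>n\<in>A'. 1 / real n) = 1)"
proof -
  define D where "D = nat \<lceil>200 / \<epsilon>\<rceil>"
  have "200 / \<epsilon> \<le> real D" by (simp add: D_def of_nat_ceiling)
  then have D: "200 \<le> \<epsilon> * real D" using assms by (simp add: pos_divide_le_eq mult.commute)
  define M where "M = (64::nat) ^ D"
  define s where "s = D * M"
  define d where "d = 3 * s + 5"
  define H where "H = D * d"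
  define \<eta> where "\<eta> = \<epsilon>\<^sup>2 / (600 * real H)"
  define \<mu> where "\<mu> = 6 * exp (6 * real H) / \<eta>"
  define m where "m = nat \<lceil>2 * (2 * \<mu> + 1)\<rceil> + 1"
  have "D \<noteq> 0" using D by (intro notI) simp
  then have H: "1 \<le> H" by (simp add: H_def d_def)
  have \<eta>: "0 < \<eta>" using assms H by (simp add: \<eta>_def)
  have m: "2 * \<mu> + 1 < real m / 2"
    using real_nat_ceiling_ge[of "2 * (2 * \<mu> + 1)"] by (simp add: m_def)
  define k where "k = (64::nat) ^ m"
  have "\<forall>\<^sub>F w in sequentially. 3 \<le> w \<and> (6 * real H * ln (real w)) ^ k \<le> real w \<and>
      480 * (real H)\<^sup>2 * ln (real w) ^ 2 \<le> \<eta> * real w \<and> 600 * real H \<le> \<epsilon> * real w \<and> 300 \<le> \<epsilon>\<^sup>2 * real w"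
  proof (intro eventually_conj)
    show "\<forall>\<^sub>F w in sequentially. 3 \<le> w" by (rule eventually_ge_at_top)
    have "\<forall>\<^sub>F w in sequentially. ln (real w) ^ k \<le> 1 / (6 * real H) ^ k * real w"
      using H by (intro eventually_ln_power_le) auto
    then show "\<forall>\<^sub>F w in sequentially. (6 * real H * ln (real w)) ^ k \<le> real w"
    proof eventually_elim
      case (elim w)
      have "0 < (6 * real H) ^ k" using H by simp
      then show ?case using elim unfolding power_mult_distrib[of "6 * real H"] by (simp add: pos_le_divide_eq mult.commute)
    qed
    have H2: "0 < 480 * (real H)\<^sup>2" using H by simp
    have "\<forall>\<^sub>F w in sequentially. ln (real w) ^ 2 \<le> \<eta> / (480 * (real H)\<^sup>2) * real w"
      using H2 \<eta> by (intro eventually_ln_power_le) auto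
    then show "\<forall>\<^sub>F w in sequentially. 480 * (real H)\<^sup>2 * ln (real w) ^ 2 \<le> \<eta> * real w"
      by eventually_elim (use H2 in \<open>simp add: pos_le_divide_eq mult.commute\<close>)
    have lin: "\<forall>\<^sub>F w in sequentially. c \<le> e * real w" if "0 < e" for c e :: real
    proof -
      have "\<forall>\<^sub>F w in sequentially. w \<ge> nat \<lceil>c / e\<rceil>" by (rule eventually_ge_at_top)
      then show ?thesis
      proof eventually_elim
        case (elim w)
        then have "c / e \<le> real w" by linarith
        then show ?case using that by (simp add: pos_divide_le_eq mult.commute)
      qed
    qed
    show "\<forall>\<^sub>F w in sequentially. 600 * real H \<le> \<epsilon> * real w" "\<forall>\<^sub>F w in sequentially. 300 \<le> \<epsilon>\<^sup>2 * real w"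
      using assms by (intro lin, simp)+
  qed
  then obtain w0 where w0: "3 \<le> w \<and> (6 * real H * ln (real w)) ^ k \<le> real w \<and>
      480 * (real H)\<^sup>2 * ln (real w) ^ 2 \<le> \<eta> * real w \<and> 600 * real H \<le> \<epsilon> * real w \<and> 300 \<le> \<epsilon>\<^sup>2 * real w" if "w0 \<le> w" for w
    unfolding eventually_sequentially by blast
  show ?thesis
  proof (intro exI[of _ "w0 ^ H"] allI impI)
    fix N A
    assume N: "w0 ^ H \<le> N" and A: "A \<subseteq> {1..N}" "(1 - 1 / exp 1 + \<epsilon>) * real N \<le> real (card A)"
    have ex: "N < (N + 1) ^ H" using self_le_power[of "N + 1" H] H by simp
    define w where "w = (LEAST x. N < (x + 1) ^ H)"
    have N_less: "N < (w + 1) ^ H" unfolding w_def using ex by (rule LeastI)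
    have "w0 \<le> w"
    proof (rule ccontr)
      assume "\<not> w0 \<le> w"
      then have "(w + 1) ^ H \<le> w0 ^ H" by (intro power_mono) auto
      then show False using N N_less by linarith
    qed
    note w = w0[OF this]
    then have w3: "3 \<le> w" by simp
    have "\<not> N < (w - 1 + 1) ^ H"
      using not_less_Least[of "w - 1" "\<lambda>x. N < (x + 1) ^ H"] w3 unfolding w_def[symmetric] by simp
    then have N_ge: "w ^ H \<le> N" using w3 by simp
    have N9: "9 \<le> N"
    proof -
      have "2 \<le> H"
        using \<open>D \<noteq> 0\<close> mult_le_mono[of 1 D 2 d] by (simp add: H_def d_def)
      then have "3 ^ 2 \<le> w ^ H"
        using w3 power_mono[of 3 w 2] power_increasing[of 2 H w] by linarith
      then show ?thesis using N_ge by simp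
    qed
    define L where "L = (LEAST l. N < 2 ^ l)"
    have "N < 2 ^ N" by simp
    then have L: "N < 2 ^ L" unfolding L_def by (rule LeastI)
    have L3: "3 \<le> L"
    proof (rule ccontr)
      assume "\<not> 3 \<le> L"
      then have "(2::nat) ^ L \<le> 2 ^ 2" by (intro power_increasing) auto
      then show False using L N9 by simp
    qed
    have ln_w: "1 \<le> ln (real w)" using ln_ge_one_nat[OF w3] .
    have H_ln: "1 \<le> real H * ln (real w)" using mult_mono[of 1 "real H" 1 "ln (real w)"] H ln_w by simp
    have L_le: "real L \<le> 6 * real H * ln (real w)"
    proof -
      have "\<not> N < 2 ^ (L - 1)"
        using not_less_Least[of "L - 1" "\<lambda>l. N < 2 ^ l"] L3 unfolding L_def[symmetric] by simp
      then have "real (2 ^ (L - 1)) \<le> real N" by (simp only: of_nat_le_iff not_less)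
      then have "ln (2 ^ (L - 1)) \<le> ln (real N)" using N9 by (subst ln_le_cancel_iff) auto
      also have "\<dots> \<le> 2 * real H * ln (real w)"
        using ln_le_of_less_Suc_power[OF w3 _ N_less] N9 by simp
      finally have "real (L - 1) * ln 2 \<le> 2 * real H * ln (real w)" by (simp add: ln_realpow)
      moreover have "1 / 2 \<le> ln (2::real)"
        using ln_le_minus_one[of "1 / 2"] by (simp add: ln_div)
      then have "real (L - 1) * (1 / 2) \<le> real (L - 1) * ln 2" by (intro mult_left_mono) auto
      ultimately have "real (L - 1) \<le> 4 * (real H * ln (real w))" by simp
      then show ?thesis using H_ln L3 by (simp add: of_nat_diff)
    qed
    interpret scales \<epsilon> \<eta> \<mu> D M s d H m w N L
    proof
      show "L ^ (64 ^ m) \<le> w"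
      proof -
        have "real L ^ k \<le> (6 * real H * ln (real w)) ^ k" using L_le by (intro power_mono) auto
        also have "\<dots> \<le> real w" using w by simp
        finally show ?thesis by (simp add: k_def flip: of_nat_power)
      qed
      show "80 * real H * real L * ln (real w) \<le> \<eta> * real w"
      proof -
        have "80 * real H * real L * ln (real w) \<le> 80 * real H * (6 * real H * ln (real w)) * ln (real w)"
          using L_le ln_w by (intro mult_right_mono mult_left_mono) auto
        also have "\<dots> = 480 * (real H)\<^sup>2 * ln (real w) ^ 2" by (simp add: power2_eq_square)
        also have "\<dots> \<le> \<eta> * real w" using w by simp
        finally show ?thesis .
      qed
    qed (use assms D M_def s_def d_def H_def \<eta>_def \<mu>_def m w3 N_ge N_less L L3 w in auto)
    show "\<exists>A'\<subseteq>A. (\<Sum>n\<in>A'. 1 / real n) = 1"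
      using exists_unit_subsum[OF A] by (simp add: recip_sum_def)
  qed
qed

end
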